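(* Let $(\mathcal S,\mathcal D,E,B)$ satisfy assumptions (i)–(iv) of the context. Let $(\theta,\eta)\in\mathcal D$. For $t\in(0,1]$ let $T_t$ be the optimal transport map from $\lambda_\theta$ to $\lambda_{\exp_\theta(t\eta)}$ and set $w_t:=(T_t-\mathrm{id})/t$. Then $\lim_{t\to0}w_t=v$ strongly in $L^2(\lambda_\theta)$, where $v=B_\theta\eta$. More quantitatively, there is a constant $C\in(0,\infty)$ that does not depend on $(\theta,\eta)$ such that for $t\in(0,1/C)$ one has $$\|v-w_t\|_{L^2(\lambda_\theta)}\le C\sqrt t\,\|\eta\|_\theta.$$
   Context: $\Omega\subset\mathbb R^d$ is compact and convex, $\mathcal P(\Omega)$ is the set of probability measures on $\Omega$, $\mathrm W$ is the Wasserstein-2 distance, $\mathrm W(\mu,\nu)^2=\inf_{\pi}\int|x-y|^2\,d\pi$ over couplings $\pi$ of $\mu,\nu$. For absolutely continuous $\mu$, the optimal transport map from $\mu$ to $\nu$ is the ($\mu$-a.e. unique) map $T$ such that $(\mathrm{id},T)_\#\mu$ is the optimal coupling (Brenier). $L^2(\mu)$ means $L^2(\mu;\mathbb R^d)$. $\|\cdot\|_{C^1(\mathbb R^d)}$ is the supremum norm of the function and its first derivatives. $\#$ denotes push-forward. Assumptions. (i) $\mathcal S$ is a compact, connected, finite-dimensional smooth Riemannian manifold with tangent norms $\|\eta\|_\theta$ ($\eta\in T_\theta\mathcal S$) and induced distance $d_{\mathcal S}$. $\mathcal D\subset T\mathcal S$ is a subset on which the Riemannian exponential map is well defined, such that $(\theta,\eta)\in\mathcal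 D$ implies $(\theta,t\eta)\in\mathcal D$ for $t\in[0,1]$; for every $(\theta,\eta)\in\mathcal D$ the curve $\gamma(t)=\exp_\theta(t\eta)$, $t\in[0,1]$, is a constant speed geodesic from $\theta$ to $\exp_\theta(\eta)$ with $\|\dot\gamma(t)\|_{\gamma(t)}=\|\eta\|_\theta=d_{\mathcal S}(\theta,\exp_\theta(\eta))$ for $t\in[0,1]$; and, with $\mathcal D_\theta=\{\eta:(\theta,\eta)\in\mathcal D\}$, for any $\theta_0,\theta_1\in\mathcal S$ there is $\eta\in\mathcal D_{\theta_0}$ with $\theta_1=\exp_{\theta_0}(\eta)$. ($\mathcal S$ may have a boundary as long as it is a geodesically convex subset of a larger, not necessarily compact, such manifold and the construction of geodesics via $\mathcal D$ remains valid.) (ii) $E:\mathcal S\to\mathcal P(\Omega)$ is a bi-Lipschitz bijection from $(\mathcal S,d_{\mathcal S})$ onto $\Lambda:=E(\mathcal S)$ with metric $\mathrm W$; write $\lambda_\theta=E(\theta)$. All $\lambda\in\Lambda$ are absolutely continuous with respect to Lebesgue measure. (iii) For each $\theta\in\mathcal S$, $B_\theta:T_\theta\mathcal S\to C^1(\mathbb R^d;\mathbb R^d)$ is linear with values in gradient vector fields, and there is $C_0\in(0,\infty)$ such that for all $(\theta,\eta)\in\mathcal D$, $x\in\mathbb R^d$, $t\in[0,1]$, with $\gamma(t)=\exp_\theta(t\eta)$: $C_0^{-1}\|\eta\|_\theta\le\|B_\theta\eta\|_{L^2(\lambda_\theta)}\le C_0\|\eta\|_\theta$; $\|B_\theta\eta\|_{C^1(\mathbb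 R^d)}\le C_0\|\eta\|_\theta$; $|\partial_t[B_{\gamma(t)}\dot\gamma(t)](x)|\le C_0\|\eta\|_\theta^2$. (iv) For every Lipschitz curve $\gamma:[0,1]\to\mathcal S$, let $v(t,\cdot)=B_{\gamma(t)}\dot\gamma(t)$ (defined for a.e. $t$) and let $\varphi:[0,1]\times\Omega\to\mathbb R^d$ be the solution of $\varphi(0,\cdot)=\mathrm{id}$, $\partial_t\varphi(t,\cdot)=v(t,\varphi(t,\cdot))$ for a.e. $t$; then $\lambda_{\gamma(t)}=\varphi(t,\cdot)_\#\lambda_{\gamma(0)}$ for all $t\in[0,1]$. *)

theory Defs
  imports "HOL-Probability.Probability"
begin

section \<open>Smooth manifolds and Riemannian metrics\<close>

text \<open>A manifold is a whole type \<open>'m\<close> with an atlas of charts \<open>(U, x)\<close> into a Euclidean space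
  \<open>'e\<close>; the values of \<open>x\<close> outside of \<open>U\<close> carry no meaning.\<close>

type_synonym ('m, 'e) chart = "'m set \<times> ('m \<Rightarrow> 'e)"

primrec Ck_on ::
  "nat \<Rightarrow> 'a::euclidean_space set \<Rightarrow> ('a \<Rightarrow> 'b::real_normed_vector) \<Rightarrow> bool" where
  "Ck_on 0 U f = continuous_on U f"
| "Ck_on (Suc k) U f =
     ((\<forall>x\<in>U. f differentiable (at x)) \<and>
      (\<forall>v. Ck_on k U (\<lambda>x. frechet_derivative f (at x) v)))"

definition smooth_on :: "'a::euclidean_space set \<Rightarrow> ('a \<Rightarrow> 'b::real_normed_vector) \<Rightarrow> bool" where
  "smooth_on U f \<longleftrightarrow> (\<forall>k. Ck_on k U f)"

definition chart_inv :: "('m, 'e) chart \<Rightarrow> 'e \<Rightarrow> 'm" where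
  "chart_inv c = inv_into (fst c) (snd c)"

definition transition :: "('m, 'e) chart \<Rightarrow> ('m, 'e) chart \<Rightarrow> 'e \<Rightarrow> 'e" where
  "transition c c' = snd c' \<circ> chart_inv c"

definition is_chart :: "('m::topological_space, 'e::euclidean_space) chart \<Rightarrow> bool" where
  "is_chart c \<longleftrightarrow> open (fst c) \<and> open (snd c ` fst c) \<and>
     homeomorphism (fst c) (snd c ` fst c) (snd c) (chart_inv c)"

definition smooth_atlas :: "('m::topological_space, 'e::euclidean_space) chart set \<Rightarrow> bool" where
  "smooth_atlas A \<longleftrightarrow>
     (\<forall>c\<in>A. is_chart c) \<and>
     (\<Union>c\<in>A. fst c) = UNIV \<and>
     (\<forall>c\<in>A. \<forall>c'\<in>A. smooth_on (snd c ` (fst c \<inter> fst c')) (transition c c'))"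

text \<open>A tangent vector at \<open>p\<close> is the family of its coordinate representations in all charts around
  \<open>p\<close>, related by the derivatives of the transition maps (and padded by \<open>0\<close> at the other charts,
  so that the representation is unique). The linear structure is the pointwise one.\<close>

type_synonym ('m, 'e) tvec = "('m, 'e) chart \<Rightarrow> 'e"

definition charts_at :: "('m, 'e) chart set \<Rightarrow> 'm \<Rightarrow> ('m, 'e) chart set" where
  "charts_at A p = {c \<in> A. p \<in> fst c}"

definition tangent_space ::
  "('m, 'e::euclidean_space) chart set \<Rightarrow> 'm \<Rightarrow> ('m, 'e) tvec set" where
  "tangent_space A p = {\<xi>.
     (\<forall>c. c \<notin> charts_at A p \<longrightarrow> \<xi> c = 0) \<and>
     (\<forall>c\<in>charts_at A p. \<forall>c'\<in>charts_at A p.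
        \<xi> c' = frechet_derivative (transition c c') (at (snd c p)) (\<xi> c))}"

definition tadd :: "('m, 'e::euclidean_space) tvec \<Rightarrow> ('m, 'e) tvec \<Rightarrow> ('m, 'e) tvec" where
  "tadd \<xi> \<zeta> = (\<lambda>c. \<xi> c + \<zeta> c)"

definition tscale :: "real \<Rightarrow> ('m, 'e::euclidean_space) tvec \<Rightarrow> ('m, 'e) tvec" where
  "tscale a \<xi> = (\<lambda>c. a *\<^sub>R \<xi> c)"

text \<open>The tangent vector at \<open>p\<close> whose coordinates in the chart \<open>c\<close> are \<open>u\<close>.\<close>

definition tvec_of ::
  "('m, 'e::euclidean_space) chart set \<Rightarrow> ('m, 'e) chart \<Rightarrow> 'm \<Rightarrow> 'e \<Rightarrow> ('m, 'e) tvec" where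
  "tvec_of A c p u = (\<lambda>c'. if c' \<in> charts_at A p
     then frechet_derivative (transition c c') (at (snd c p)) u else 0)"

type_synonym ('m, 'e) metric = "'m \<Rightarrow> ('m, 'e) tvec \<Rightarrow> ('m, 'e) tvec \<Rightarrow> real"

definition metric_coord ::
  "('m, 'e::euclidean_space) chart set \<Rightarrow> ('m, 'e) metric \<Rightarrow> ('m, 'e) chart
     \<Rightarrow> 'e \<Rightarrow> 'e \<Rightarrow> 'e \<Rightarrow> real" where
  "metric_coord A g c x u w =
     g (chart_inv c x) (tvec_of A c (chart_inv c x) u) (tvec_of A c (chart_inv c x) w)"

definition riemannian_metric ::
  "('m::topological_space, 'e::euclidean_space) chart set \<Rightarrow> ('m, 'e) metric \<Rightarrow> bool" where
  "riemannian_metric A g \<longleftrightarrow>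
     (\<forall>p. \<forall>\<xi>\<in>tangent_space A p. \<forall>\<zeta>\<in>tangent_space A p.
        g p \<xi> \<zeta> = g p \<zeta> \<xi> \<and>
        (\<forall>\<rho>\<in>tangent_space A p. \<forall>a b.
           g p (tadd (tscale a \<xi>) (tscale b \<zeta>)) \<rho> = a * g p \<xi> \<rho> + b * g p \<zeta> \<rho>)) \<and>
     (\<forall>p. \<forall>\<xi>\<in>tangent_space A p. \<xi> \<noteq> (\<lambda>_. 0) \<longrightarrow> g p \<xi> \<xi> > 0) \<and>
     (\<forall>c\<in>A. \<forall>u w. smooth_on (snd c ` fst c) (\<lambda>x. metric_coord A g c x u w))"

definition connected_riemannian_manifold ::
  "('m::{t2_space,second_countable_topology}, 'e::euclidean_space) chart set
     \<Rightarrow> ('m, 'e) metric \<Rightarrow> bool" where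
  "connected_riemannian_manifold A g \<longleftrightarrow>
     connected (UNIV :: 'm set) \<and> smooth_atlas A \<and> riemannian_metric A g"

definition tnorm :: "('m, 'e) metric \<Rightarrow> 'm \<Rightarrow> ('m, 'e) tvec \<Rightarrow> real" where
  "tnorm g p \<xi> = sqrt (g p \<xi> \<xi>)"


section \<open>Curves, geodesics, the exponential map, and distance\<close>

definition has_velocity ::
  "('m::topological_space, 'e::euclidean_space) chart set \<Rightarrow> (real \<Rightarrow> 'm) \<Rightarrow> real set
     \<Rightarrow> real \<Rightarrow> ('m, 'e) tvec \<Rightarrow> bool" where
  "has_velocity A \<gamma> I t \<xi> \<longleftrightarrow>
     \<xi> \<in> tangent_space A (\<gamma> t) \<and> continuous (at t within I) \<gamma> \<and>
     (\<forall>c\<in>charts_at A (\<gamma> t). ((snd c \<circ> \<gamma>) has_vector_derivative \<xi> c) (at t within I))"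

definition velocity ::
  "('m::topological_space, 'e::euclidean_space) chart set \<Rightarrow> (real \<Rightarrow> 'm) \<Rightarrow> real
     \<Rightarrow> ('m, 'e) tvec" where
  "velocity A \<gamma> t = (THE \<xi>. has_velocity A \<gamma> {0..1} t \<xi>)"

text \<open>Christoffel symbols of the first kind:
  \<open>\<Gamma>(u, v; w) = (\<partial>\<^sub>u G(v, w) + \<partial>\<^sub>v G(u, w) - \<partial>\<^sub>w G(u, v)) / 2\<close>.\<close>

definition christoffel ::
  "('m, 'e::euclidean_space) chart set \<Rightarrow> ('m, 'e) metric \<Rightarrow> ('m, 'e) chart
     \<Rightarrow> 'e \<Rightarrow> 'e \<Rightarrow> 'e \<Rightarrow> 'e \<Rightarrow> real" where
  "christoffel A g c x u v w =
     (frechet_derivative (\<lambda>z. metric_coord A g c z v w) (at x) u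
    + frechet_derivative (\<lambda>z. metric_coord A g c z u w) (at x) v
    - frechet_derivative (\<lambda>z. metric_coord A g c z u v) (at x) w) / 2"

text \<open>The geodesic equation in each chart, with the free index lowered by the metric; testing
  against all \<open>w\<close> avoids the inverse metric.\<close>

definition is_geodesic ::
  "('m::topological_space, 'e::euclidean_space) chart set \<Rightarrow> ('m, 'e) metric
     \<Rightarrow> (real \<Rightarrow> 'm) \<Rightarrow> bool" where
  "is_geodesic A g \<gamma> \<longleftrightarrow> continuous_on {0..1} \<gamma> \<and>
     (\<forall>c\<in>A. \<exists>x' x''. \<forall>t\<in>{s\<in>{0..1}. \<gamma> s \<in> fst c}.
        ((snd c \<circ> \<gamma>) has_vector_derivative x' t) (at t within {s\<in>{0..1}. \<gamma> s \<in> fst c}) \<and>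
        (x' has_vector_derivative x'' t) (at t within {s\<in>{0..1}. \<gamma> s \<in> fst c}) \<and>
        (\<forall>w. metric_coord A g c (snd c (\<gamma> t)) (x'' t) w
              + christoffel A g c (snd c (\<gamma> t)) (x' t) (x' t) w = 0))"

definition geodesic_from ::
  "('m::topological_space, 'e::euclidean_space) chart set \<Rightarrow> ('m, 'e) metric
     \<Rightarrow> 'm \<Rightarrow> ('m, 'e) tvec \<Rightarrow> (real \<Rightarrow> 'm) \<Rightarrow> bool" where
  "geodesic_from A g p \<xi> \<gamma> \<longleftrightarrow>
     is_geodesic A g \<gamma> \<and> \<gamma> 0 = p \<and> has_velocity A \<gamma> {0..1} 0 \<xi>"

definition exp_domain ::
  "('m::topological_space, 'e::euclidean_space) chart set \<Rightarrow> ('m, 'e) metric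
     \<Rightarrow> ('m \<times> ('m, 'e) tvec) set" where
  "exp_domain A g = {(p, \<xi>). \<xi> \<in> tangent_space A p \<and> (\<exists>\<gamma>. geodesic_from A g p \<xi> \<gamma>)}"

definition riem_exp ::
  "('m::topological_space, 'e::euclidean_space) chart set \<Rightarrow> ('m, 'e) metric
     \<Rightarrow> 'm \<Rightarrow> ('m, 'e) tvec \<Rightarrow> 'm" where
  "riem_exp A g p \<xi> = (THE q. \<exists>\<gamma>. geodesic_from A g p \<xi> \<gamma> \<and> q = \<gamma> 1)"

definition C1_curve_on ::
  "('m::topological_space, 'e::euclidean_space) chart set \<Rightarrow> real \<Rightarrow> real
     \<Rightarrow> (real \<Rightarrow> 'm) \<Rightarrow> bool" where
  "C1_curve_on A a b \<gamma> \<longleftrightarrow>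
     (\<exists>\<xi>. (\<forall>t\<in>{a..b}. has_velocity A \<gamma> {a..b} t (\<xi> t)) \<and>
          (\<forall>c\<in>A. continuous_on {t\<in>{a..b}. \<gamma> t \<in> fst c} (\<lambda>t. \<xi> t c)))"

definition piecewise_C1_curve ::
  "('m::topological_space, 'e::euclidean_space) chart set \<Rightarrow> (real \<Rightarrow> 'm) \<Rightarrow> bool" where
  "piecewise_C1_curve A \<gamma> \<longleftrightarrow> continuous_on {0..1} \<gamma> \<and>
     (\<exists>F. finite F \<and> {0, 1} \<subseteq> F \<and> F \<subseteq> {0..1} \<and>
        (\<forall>a\<in>F. \<forall>b\<in>F. a < b \<and> F \<inter> {a<..<b} = {} \<longrightarrow> C1_curve_on A a b \<gamma>))"

definition curve_length ::
  "('m::topological_space, 'e::euclidean_space) chart set \<Rightarrow> ('m, 'e) metric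
     \<Rightarrow> (real \<Rightarrow> 'm) \<Rightarrow> real" where
  "curve_length A g \<gamma> = integral {0..1} (\<lambda>t. tnorm g (\<gamma> t) (velocity A \<gamma> t))"

text \<open>The distance induced by the metric on a subset \<open>S\<close>, i.e. the infimum of the lengths of curves
  in \<open>S\<close>. For \<open>S = UNIV\<close> this is the usual Riemannian distance.\<close>

definition riem_dist ::
  "('m::topological_space, 'e::euclidean_space) chart set \<Rightarrow> ('m, 'e) metric
     \<Rightarrow> 'm set \<Rightarrow> 'm \<Rightarrow> 'm \<Rightarrow> real" where
  "riem_dist A g S p q = Inf {curve_length A g \<gamma> |\<gamma>.
     piecewise_C1_curve A \<gamma> \<and> \<gamma> ` {0..1} \<subseteq> S \<and> \<gamma> 0 = p \<and> \<gamma> 1 = q}"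

definition geodesically_convex ::
  "('m::topological_space, 'e::euclidean_space) chart set \<Rightarrow> ('m, 'e) metric
     \<Rightarrow> 'm set \<Rightarrow> bool" where
  "geodesically_convex A g S \<longleftrightarrow> (\<forall>p\<in>S. \<forall>q\<in>S. \<exists>\<gamma>. is_geodesic A g \<gamma> \<and>
     \<gamma> 0 = p \<and> \<gamma> 1 = q \<and> \<gamma> ` {0..1} \<subseteq> S \<and> curve_length A g \<gamma> = riem_dist A g S p q)"

definition lipschitz_curve ::
  "('m::topological_space, 'e::euclidean_space) chart set \<Rightarrow> ('m, 'e) metric
     \<Rightarrow> 'm set \<Rightarrow> (real \<Rightarrow> 'm) \<Rightarrow> bool" where
  "lipschitz_curve A g S \<gamma> \<longleftrightarrow> \<gamma> ` {0..1} \<subseteq> S \<and>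
     (\<exists>L. \<forall>s\<in>{0..1}. \<forall>t\<in>{0..1}. riem_dist A g S (\<gamma> s) (\<gamma> t) \<le> L * \<bar>s - t\<bar>)"


section \<open>Optimal transport\<close>

definition prob_measures_on :: "'a::euclidean_space set \<Rightarrow> 'a measure set" where
  "prob_measures_on \<Omega> = {\<mu>. sets \<mu> = sets borel \<and> prob_space \<mu> \<and> emeasure \<mu> \<Omega> = 1}"

definition couplings ::
  "'a::euclidean_space measure \<Rightarrow> 'a measure \<Rightarrow> ('a \<times> 'a) measure set" where
  "couplings \<mu> \<nu> =
     {\<pi>. sets \<pi> = sets (borel \<Otimes>\<^sub>M borel) \<and> distr \<pi> borel fst = \<mu> \<and> distr \<pi> borel snd = \<nu>}"

definition transport_cost :: "('a::euclidean_space \<times> 'a) measure \<Rightarrow> ennreal" where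
  "transport_cost \<pi> = (\<integral>\<^sup>+ (x, y). ennreal ((norm (x - y))\<^sup>2) \<partial>\<pi>)"

definition wasserstein :: "'a::euclidean_space measure \<Rightarrow> 'a measure \<Rightarrow> real" where
  "wasserstein \<mu> \<nu> = sqrt (enn2real (INF \<pi>\<in>couplings \<mu> \<nu>. transport_cost \<pi>))"

definition optimal_map ::
  "'a::euclidean_space measure \<Rightarrow> 'a measure \<Rightarrow> ('a \<Rightarrow> 'a) \<Rightarrow> bool" where
  "optimal_map \<mu> \<nu> T \<longleftrightarrow> T \<in> borel_measurable \<mu> \<and>
     (let \<pi> = distr \<mu> (borel \<Otimes>\<^sub>M borel) (\<lambda>x. (x, T x)) in
        \<pi> \<in> couplings \<mu> \<nu> \<and> (\<forall>\<pi>'\<in>couplings \<mu> \<nu>. transport_cost \<pi> \<le> transport_cost \<pi>'))"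


section \<open>Vector fields and flows\<close>

definition in_L2 ::
  "'a::euclidean_space measure \<Rightarrow> ('a \<Rightarrow> 'a) \<Rightarrow> bool" where
  "in_L2 \<mu> f \<longleftrightarrow> f \<in> borel_measurable \<mu> \<and> integrable \<mu> (\<lambda>x. (norm (f x))\<^sup>2)"

definition L2_norm :: "'a::euclidean_space measure \<Rightarrow> ('a \<Rightarrow> 'a) \<Rightarrow> real" where
  "L2_norm \<mu> f = sqrt (\<integral>x. (norm (f x))\<^sup>2 \<partial>\<mu>)"

text \<open>The supremum norm of the derivative uses the operator norm; the value may be infinite.\<close>

definition C1_norm :: "('a::euclidean_space \<Rightarrow> 'a) \<Rightarrow> ennreal" where
  "C1_norm f = max (SUP x. ennreal (norm (f x)))
                   (SUP x. ennreal (onorm (frechet_derivative f (at x))))"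

definition gradient_field :: "('a::euclidean_space \<Rightarrow> 'a) \<Rightarrow> bool" where
  "gradient_field f \<longleftrightarrow> (\<exists>\<psi>::'a \<Rightarrow> real. \<forall>x. GDERIV \<psi> x :> f x)"

text \<open>Absolute continuity on \<open>[0,1]\<close>.\<close>

definition abs_continuous_curve :: "(real \<Rightarrow> 'a::real_normed_vector) \<Rightarrow> bool" where
  "abs_continuous_curve f \<longleftrightarrow> (\<forall>\<epsilon>>0. \<exists>\<delta>>0. \<forall>P::(real \<times> real) set.
     finite P \<and> (\<forall>(a, b)\<in>P. 0 \<le> a \<and> a \<le> b \<and> b \<le> 1) \<and>
     disjoint_family_on (\<lambda>(a, b). {a<..<b}) P \<and> (\<Sum>(a, b)\<in>P. b - a) < \<delta>
     \<longrightarrow> (\<Sum>(a, b)\<in>P. norm (f b - f a)) < \<epsilon>)"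

text \<open>Solutions in the sense of Caratheodory: absolutely continuous in time, equation almost
  everywhere in time.\<close>

definition flow_solution ::
  "'a::euclidean_space set \<Rightarrow> (real \<Rightarrow> 'a \<Rightarrow> 'a) \<Rightarrow> (real \<Rightarrow> 'a \<Rightarrow> 'a) \<Rightarrow> bool" where
  "flow_solution \<Omega> v \<phi> \<longleftrightarrow>
     (\<forall>x\<in>\<Omega>. \<phi> 0 x = x \<and> abs_continuous_curve (\<lambda>t. \<phi> t x)) \<and>
     (AE t in lborel. t \<in> {0..1} \<longrightarrow>
        (\<forall>x\<in>\<Omega>. ((\<lambda>s. \<phi> s x) has_vector_derivative v t (\<phi> t x)) (at t within {0..1})))"


section \<open>Standing assumptions\<close>

text \<open>The parameter space \<open>S\<close> is a subset of the manifold \<open>'m\<close>: taking \<open>S = UNIV\<close> gives a compact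
  manifold without boundary, and a proper subset is the case of a geodesically convex subset of a
  larger manifold, which need not be compact. All tangent spaces are those of \<open>'m\<close>.
  The clause \<open>geodesic_from\<close> below includes the defining property of the exponential map that the
  curve \<open>t \<mapsto> exp (t \<eta>)\<close> has initial velocity \<open>\<eta>\<close>.\<close>

definition geodesic_space ::
  "('m::{t2_space,second_countable_topology}, 'e::euclidean_space) chart set
     \<Rightarrow> ('m, 'e) metric \<Rightarrow> 'm set \<Rightarrow> ('m \<times> ('m, 'e) tvec) set \<Rightarrow> bool" where
  "geodesic_space A g S D \<longleftrightarrow>
     connected_riemannian_manifold A g \<and> compact S \<and> connected S \<and> geodesically_convex A g S \<and>
     D \<subseteq> exp_domain A g \<inter> (S \<times> UNIV) \<and>
     (\<forall>(\<theta>, \<eta>)\<in>D. \<forall>t\<in>{0..1}. (\<theta>, tscale t \<eta>) \<in> D) \<and>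
     (\<forall>(\<theta>, \<eta>)\<in>D. let \<gamma> = (\<lambda>t. riem_exp A g \<theta> (tscale t \<eta>)) in
        geodesic_from A g \<theta> \<eta> \<gamma> \<and> \<gamma> ` {0..1} \<subseteq> S \<and>
        (\<forall>t\<in>{0..1}. tnorm g (\<gamma> t) (velocity A \<gamma> t) = tnorm g \<theta> \<eta>) \<and>
        tnorm g \<theta> \<eta> = riem_dist A g S \<theta> (riem_exp A g \<theta> \<eta>)) \<and>
     (\<forall>\<theta>0\<in>S. \<forall>\<theta>1\<in>S. \<exists>\<eta>. (\<theta>0, \<eta>) \<in> D \<and> \<theta>1 = riem_exp A g \<theta>0 \<eta>)"

definition wasserstein_embedding ::
  "('m::{t2_space,second_countable_topology}, 'e::euclidean_space) chart set
     \<Rightarrow> ('m, 'e) metric \<Rightarrow> 'm set \<Rightarrow> 'a::euclidean_space set \<Rightarrow> ('m \<Rightarrow> 'a measure) \<Rightarrow> bool" where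
  "wasserstein_embedding A g S \<Omega> E \<longleftrightarrow>
     E ` S \<subseteq> prob_measures_on \<Omega> \<and> inj_on E S \<and>
     (\<exists>L>0. \<forall>\<theta>0\<in>S. \<forall>\<theta>1\<in>S.
        wasserstein (E \<theta>0) (E \<theta>1) \<le> L * riem_dist A g S \<theta>0 \<theta>1 \<and>
        riem_dist A g S \<theta>0 \<theta>1 \<le> L * wasserstein (E \<theta>0) (E \<theta>1)) \<and>
     (\<forall>\<theta>\<in>S. absolutely_continuous lborel (E \<theta>))"

definition velocity_fields ::
  "('m::{t2_space,second_countable_topology}, 'e::euclidean_space) chart set
     \<Rightarrow> ('m, 'e) metric \<Rightarrow> 'm set \<Rightarrow> ('m \<times> ('m, 'e) tvec) set
     \<Rightarrow> ('m \<Rightarrow> 'a::euclidean_space measure) \<Rightarrow> ('m \<Rightarrow> ('m, 'e) tvec \<Rightarrow> 'a \<Rightarrow> 'a) \<Rightarrow> bool" where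
  "velocity_fields A g S D E B \<longleftrightarrow>
     (\<forall>\<theta>\<in>S. \<forall>\<xi>\<in>tangent_space A \<theta>.
        Ck_on 1 UNIV (B \<theta> \<xi>) \<and> gradient_field (B \<theta> \<xi>) \<and>
        (\<forall>\<zeta>\<in>tangent_space A \<theta>. \<forall>a b x.
           B \<theta> (tadd (tscale a \<xi>) (tscale b \<zeta>)) x = a *\<^sub>R B \<theta> \<xi> x + b *\<^sub>R B \<theta> \<zeta> x)) \<and>
     (\<exists>C\<^sub>0>0. \<forall>(\<theta>, \<eta>)\<in>D. let \<gamma> = (\<lambda>t. riem_exp A g \<theta> (tscale t \<eta>)) in
        tnorm g \<theta> \<eta> / C\<^sub>0 \<le> L2_norm (E \<theta>) (B \<theta> \<eta>) \<and>
        L2_norm (E \<theta>) (B \<theta> \<eta>) \<le> C\<^sub>0 * tnorm g \<theta> \<eta> \<and>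
        C1_norm (B \<theta> \<eta>) \<le> ennreal (C\<^sub>0 * tnorm g \<theta> \<eta>) \<and>
        (\<forall>x. \<forall>t\<in>{0..1}. \<exists>w.
           ((\<lambda>s. B (\<gamma> s) (velocity A \<gamma> s) x) has_vector_derivative w) (at t within {0..1}) \<and>
           norm w \<le> C\<^sub>0 * (tnorm g \<theta> \<eta>)\<^sup>2))"

text \<open>The flow map \<open>\<phi> t\<close> is only meaningful on \<open>\<Omega>\<close>, hence the restriction before the push-forward
  (the measures are concentrated on \<open>\<Omega>\<close>).\<close>

definition transported_by_flows ::
  "('m::{t2_space,second_countable_topology}, 'e::euclidean_space) chart set
     \<Rightarrow> ('m, 'e) metric \<Rightarrow> 'm set \<Rightarrow> 'a::euclidean_space set
     \<Rightarrow> ('m \<Rightarrow> 'a measure) \<Rightarrow> ('m \<Rightarrow> ('m, 'e) tvec \<Rightarrow> 'a \<Rightarrow> 'a) \<Rightarrow> bool" where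
  "transported_by_flows A g S \<Omega> E B \<longleftrightarrow>
     (\<forall>\<gamma> \<phi>. lipschitz_curve A g S \<gamma> \<and>
        flow_solution \<Omega> (\<lambda>t. B (\<gamma> t) (velocity A \<gamma> t)) \<phi> \<longrightarrow>
        (\<forall>t\<in>{0..1}. E (\<gamma> t) = distr (restrict_space (E (\<gamma> 0)) \<Omega>) borel (\<phi> t)))"

end

theory Submission
  imports Defs "HOL-Complex_Analysis.Great_Picard"
begin

text \<open>Let \<open>\<phi>\<close> be a flow along the geodesic \<open>exp (t \<eta>)\<close>, so that \<open>\<phi> t\<close> pushes \<open>E \<theta>\<close> forward to the
  same measure as the optimal map \<open>T t\<close>, with displacement \<open>t v + O(t\<^sup>2)\<close>. Write \<open>v = \<nabla>\<psi>\<close>. By Taylor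
  expansion of the \<open>C\<^sup>1\<^sup>,\<^sup>1\<close> potential \<open>\<psi>\<close>, the pairing of \<open>v\<close> with the displacement of either map is
  \<open>\<integral> \<psi> d(E (exp (t \<eta>))) - \<integral> \<psi> d(E \<theta>)\<close> up to an error that is quadratic in the displacement. Since
  \<open>T t\<close> has the smaller norm of displacement, expanding the square gives
  \<open>\<parallel>T t - id - t v\<parallel>\<^sup>2 \<le> \<parallel>\<phi> t - id - t v\<parallel>\<^sup>2 + O(t \<parallel>\<phi> t - id\<parallel>\<^sup>2) = O(t\<^sup>3)\<close>.
  The \<open>C\<^sup>1\<close> bound on the velocity field is available only at time \<open>0\<close>, since \<open>D\<close> need not contain the
  velocities of the geodesic at later times. Hence the flow comes from Peano's theorem, without
  uniqueness, and the measurability of \<open>\<phi> t\<close> is deduced from the push-forward being a probability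
  measure.\<close>

section \<open>Existence of flows\<close>

text \<open>The mean value inequality with derivatives taken within \<open>I\<close>, so one-sided
  derivatives at end points count. It serves the approximations, the flow and the time dependence of
  the field.\<close>

lemma vector_derivative_bound_Lipschitz:
  fixes u :: "real \<Rightarrow> 'a::real_normed_vector"
  assumes "convex I"
    and "\<And>t. t \<in> I \<Longrightarrow> (u has_vector_derivative u' t) (at t within I)"
    and "\<And>t. t \<in> I \<Longrightarrow> norm (u' t) \<le> M"
    and "s \<in> I" "t \<in> I"
  shows "norm (u t - u s) \<le> M * \<bar>t - s\<bar>"
proof -
  have "norm (u t - u s) \<le> M * norm (t - s)"
  proof (rule differentiable_bound[OF assms(1)])
    fix r assume r: "r \<in> I"
    show "(u has_derivative (\<lambda>h. h *\<^sub>R u' r)) (at r within I)"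
      using assms(2)[OF r] by (simp add: has_vector_derivative_def)
    show "onorm (\<lambda>h. h *\<^sub>R u' r) \<le> M"
      using assms(3)[OF r] by (intro onorm_le) (simp add: mult.commute[of M] mult_left_mono)
  qed (use assms in auto)
  then show ?thesis by simp
qed

text \<open>Tonelli's approximations: the equation with its right-hand side delayed by \<open>\<tau>\<close> is solved
  exactly on \<open>[0, j \<tau>]\<close> by the \<open>j\<close>-th iterate.\<close>

primrec delayed_iterate ::
  "(real \<Rightarrow> 'a::euclidean_space \<Rightarrow> 'a) \<Rightarrow> 'a \<Rightarrow> real \<Rightarrow> nat \<Rightarrow> real \<Rightarrow> 'a" where
  "delayed_iterate f x0 \<tau> 0 = (\<lambda>t. x0)"
| "delayed_iterate f x0 \<tau> (Suc j) =
     (\<lambda>t. x0 + integral {0..t} (\<lambda>s. f s (delayed_iterate f x0 \<tau> j (max 0 (s - \<tau>)))))"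

text \<open>Clipping the delayed time at 0 keeps it inside the unit interval when \<open>s\<close>
  is smaller than the delay, so continuity of \<open>u\<close> there is enough.\<close>

lemma continuous_on_delayed_rhs:
  fixes u :: "real \<Rightarrow> 'a::euclidean_space"
  assumes "continuous_on ({0..1} \<times> UNIV) (\<lambda>(t, x). f t x)"
    and "continuous_on {0..1} u" "\<tau> \<ge> 0"
  shows "continuous_on {0..1} (\<lambda>s. f s (u (max 0 (s - \<tau>))))"
proof -
  have "continuous_on {0..1} (\<lambda>s. u (max 0 (s - \<tau>)))"
    by (rule continuous_on_compose2[OF assms(2)]) (use assms(3) in \<open>auto intro!: continuous_intros\<close>)
  then have "continuous_on {0..1} (\<lambda>s. (s, u (max 0 (s - \<tau>))))"
    by (intro continuous_intros)
  from continuous_on_compose2[OF assms(1) this] show ?thesis by auto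
qed

text \<open>Each iterate is constant or the primitive of a function bounded by \<open>M\<close>. The
  bound is uniform in the delay and in \<open>j\<close>, which yields equicontinuity.\<close>

lemma delayed_iterate_Lipschitz:
  assumes cont: "continuous_on ({0..1} \<times> UNIV) (\<lambda>(t, x). f t x)"
    and bd: "\<And>t x. t \<in> {0..1} \<Longrightarrow> norm (f t x) \<le> M" and \<tau>: "\<tau> \<ge> 0"
    and st: "s \<in> {0..1}" "t \<in> {0..1}"
  shows "continuous_on {0..1} (delayed_iterate f x0 \<tau> j)"
    and "norm (delayed_iterate f x0 \<tau> j t - delayed_iterate f x0 \<tau> j s) \<le> M * \<bar>t - s\<bar>"
proof -
  have M: "M \<ge> 0" by (rule order_trans[OF norm_ge_zero bd[of 0 0]]) simp
  \<comment> \<open>Both claims go through one induction: continuity of an iterate is what allows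
    differentiating the integral that defines the next.\<close>
  have *: "continuous_on {0..1} (delayed_iterate f x0 \<tau> j) \<and> (\<forall>s\<in>{0..1}. \<forall>t\<in>{0..1}.
     norm (delayed_iterate f x0 \<tau> j t - delayed_iterate f x0 \<tau> j s) \<le> M * \<bar>t - s\<bar>)"
  proof (induction j)
    case 0
    then show ?case using M by simp
  next
    case (Suc j)
    let ?h = "\<lambda>s. f s (delayed_iterate f x0 \<tau> j (max 0 (s - \<tau>)))"
    let ?u = "delayed_iterate f x0 \<tau> (Suc j)"
    have der: "(?u has_vector_derivative ?h t) (at t within {0..1})" if "t \<in> {0..1}" for t
      using integral_has_vector_derivative[OF continuous_on_delayed_rhs[OF cont _ \<tau>] that] Suc
      by (auto intro!: derivative_eq_intros)
    have "continuous_on {0..1} ?u"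
      using der has_vector_derivative_continuous unfolding continuous_on_eq_continuous_within by blast
    moreover have "norm (?u t - ?u s) \<le> M * \<bar>t - s\<bar>" if "s \<in> {0..1}" "t \<in> {0..1}" for s t
      by (rule vector_derivative_bound_Lipschitz[OF _ der]) (use bd that in auto)
    ultimately show ?case by blast
  qed
  show "continuous_on {0..1} (delayed_iterate f x0 \<tau> j)" using * by blast
  show "norm (delayed_iterate f x0 \<tau> j t - delayed_iterate f x0 \<tau> j s) \<le> M * \<bar>t - s\<bar>"
    using * st by blast
qed

text \<open>The value at \<open>t\<close> uses the previous iterate only up to time
  \<open>t - \<tau>\<close>, so each round extends the interval of agreement by one delay. For
  \<open>j = 0\<close> only \<open>t = 0\<close> remains, where the integral vanishes.\<close>

lemma delayed_iterate_stationary: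
  assumes "\<tau> \<ge> 0" "0 \<le> t" "t \<le> real j * \<tau>"
  shows "delayed_iterate f x0 \<tau> (Suc j) t = delayed_iterate f x0 \<tau> j t"
  using assms(2,3)
proof (induction j arbitrary: t)
  case 0
  then show ?case by simp
next
  case (Suc j)
  have "delayed_iterate f x0 \<tau> (Suc j) (max 0 (s - \<tau>)) = delayed_iterate f x0 \<tau> j (max 0 (s - \<tau>))"
    if "s \<in> {0..t}" for s
    using that Suc.prems assms(1) by (intro Suc.IH) (auto simp: algebra_simps)
  then show ?case
    unfolding delayed_iterate.simps(2)[of _ _ _ "Suc j"]
    by (subst integral_cong[where g="\<lambda>s. f s (delayed_iterate f x0 \<tau> j (max 0 (s - \<tau>)))"])
      (auto simp del: delayed_iterate.simps(2) simp: delayed_iterate.simps(2)[of f x0 \<tau> j])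
qed

text \<open>Arzela-Ascoli extracts a uniform limit from Tonelli's approximations, and the integral
  equation passes to the limit. The global bound on \<open>f\<close> gives existence on all of
  \<open>{0..1}\<close>.\<close>

theorem Peano_existence:
  fixes f :: "real \<Rightarrow> 'a::euclidean_space \<Rightarrow> 'a"
  assumes cont: "continuous_on ({0..1} \<times> UNIV) (\<lambda>(t, x). f t x)"
    and bd: "\<And>t x. t \<in> {0..1} \<Longrightarrow> norm (f t x) \<le> M"
  obtains u where "u 0 = x0"
    and "\<And>t. t \<in> {0..1} \<Longrightarrow> (u has_vector_derivative f t (u t)) (at t within {0..1})"
proof -
  have M: "M \<ge> 0" by (rule order_trans[OF norm_ge_zero bd[of 0 0]]) simp
  define \<tau> where "\<tau> n = inverse (real (Suc n))" for n
  \<comment> \<open>With delay \<open>1 / (n + 1)\<close>, the iterate of index \<open>n + 1\<close>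
    is stationary up to time 1, hence solves the delayed equation on the whole interval.\<close>
  define Y where "Y n = delayed_iterate f x0 (\<tau> n) (Suc n)" for n
  have \<tau>: "\<tau> n \<ge> 0" for n by (simp add: \<tau>_def)
  have Ycont: "continuous_on {0..1} (Y n)" for n
    unfolding Y_def by (rule delayed_iterate_Lipschitz(1)[OF cont bd \<tau>, of 0 0]) auto
  have Ylip: "norm (Y n t - Y n s) \<le> M * \<bar>t - s\<bar>" if "s \<in> {0..1}" "t \<in> {0..1}" for n s t
    unfolding Y_def by (rule delayed_iterate_Lipschitz(2)[OF cont bd \<tau> that])
  let ?h = "\<lambda>n s. f s (Y n (max 0 (s - \<tau> n)))"
  have Yeq: "Y n t = x0 + integral {0..t} (?h n)" if "t \<in> {0..1}" for n t
    using delayed_iterate_stationary[of "\<tau> n" t "Suc n" f x0] that \<tau>[of n]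
    unfolding Y_def by (simp add: \<tau>_def)
  have Y0: "Y n 0 = x0" for n using Yeq[of 0 n] by simp
  have Ybd: "norm (Y n t) \<le> norm x0 + M" if "t \<in> {0..1}" for n t
  proof -
    have "norm (Y n t - Y n 0) \<le> M * \<bar>t - 0\<bar>" using that by (intro Ylip) auto
    also have "\<dots> \<le> M" using that M by (simp add: mult_left_le)
    finally show ?thesis using Y0 norm_triangle_sub[of "Y n t" x0] by simp
  qed
  \<comment> \<open>Equicontinuity at \<open>t\<close>; dividing by \<open>M + 1\<close> covers the
    case \<open>M = 0\<close>.\<close>
  have "\<exists>d>0. \<forall>n s. s \<in> {0..1} \<and> norm (t - s) < d \<longrightarrow> norm (Y n t - Y n s) < e"
    if "t \<in> {0..1}" "0 < e" for t e
  proof (intro exI[of _ "e / (M + 1)"] conjI allI impI)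
    show "0 < e / (M + 1)" using that M by simp
    fix n s assume s: "s \<in> {0..1} \<and> norm (t - s) < e / (M + 1)"
    have "norm (Y n t - Y n s) \<le> M * \<bar>t - s\<bar>" using s that by (intro Ylip) auto
    also have "\<dots> \<le> (M + 1) * \<bar>t - s\<bar>" using M by (simp add: mult_right_mono)
    also have "\<dots> < e" using s M by (simp add: field_simps)
    finally show "norm (Y n t - Y n s) < e" .
  qed
  from Arzela_Ascoli[OF compact_Icc Ybd this] obtain u k where
    u: "continuous_on {0..1} u" and k: "strict_mono (k :: nat \<Rightarrow> nat)"
    and unif: "\<And>e. 0 < e \<Longrightarrow> \<exists>N. \<forall>n x. n \<ge> N \<and> x \<in> {0..1} \<longrightarrow> norm (Y (k n) x - u x) < e"
    by metis
  have lim: "(\<lambda>n. Y (k n) t) \<longlonglongrightarrow> u t" if "t \<in> {0..1}" for t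
    unfolding LIMSEQ_iff using unif that by metis
  have \<tau>0: "(\<lambda>n. \<tau> (k n)) \<longlonglongrightarrow> 0"
    using LIMSEQ_subseq_LIMSEQ[OF LIMSEQ_inverse_real_of_nat k] by (simp add: \<tau>_def o_def)
  \<comment> \<open>The delay moves the argument by at most \<open>\<tau> (k n)\<close>, which the
    common Lipschitz constant turns into an error tending to 0.\<close>
  have lim': "(\<lambda>n. Y (k n) (max 0 (s - \<tau> (k n)))) \<longlonglongrightarrow> u s" if s: "s \<in> {0..1}" for s
  proof (rule Lim_transform2[OF lim[OF s]])
    show "(\<lambda>n. Y (k n) s - Y (k n) (max 0 (s - \<tau> (k n)))) \<longlonglongrightarrow> 0"
    proof (rule Lim_null_comparison[where g="\<lambda>n. M * \<tau> (k n)"])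
      show "\<forall>\<^sub>F n in sequentially. norm (Y (k n) s - Y (k n) (max 0 (s - \<tau> (k n)))) \<le> M * \<tau> (k n)"
      proof (intro always_eventually allI)
        fix n
        have "norm (Y (k n) s - Y (k n) (max 0 (s - \<tau> (k n)))) \<le> M * \<bar>s - max 0 (s - \<tau> (k n))\<bar>"
          using s \<tau>[of "k n"] by (intro Ylip) auto
        also have "\<dots> \<le> M * \<tau> (k n)" using s \<tau>[of "k n"] M by (intro mult_left_mono) auto
        finally show "norm (Y (k n) s - Y (k n) (max 0 (s - \<tau> (k n)))) \<le> M * \<tau> (k n)" .
      qed
      show "(\<lambda>n. M * \<tau> (k n)) \<longlonglongrightarrow> 0" using tendsto_mult_right_zero[OF \<tau>0] .
    qed
  qed
  have limf: "(\<lambda>n. ?h (k n) s) \<longlonglongrightarrow> f s (u s)" if s: "s \<in> {0..1}" for s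
  proof -
    have "continuous_on UNIV (\<lambda>x. case (s, x) of (t, y) \<Rightarrow> f t y)"
    proof (rule continuous_on_compose2[OF cont])
      show "continuous_on UNIV (\<lambda>x. (s, x))"
        by (intro continuous_on_Pair continuous_on_const continuous_on_id)
    qed (use s in auto)
    then have "continuous_on UNIV (f s)" by simp
    then show ?thesis
      using lim'[OF s] continuous_on_tendsto_compose[of UNIV "f s"] by auto
  qed
  have "continuous_on {0..1} (\<lambda>s. case (s, u s) of (t, x) \<Rightarrow> f t x)"
    by (rule continuous_on_compose2[OF cont continuous_on_Pair[OF continuous_on_id u]]) auto
  then have ucont: "continuous_on {0..1} (\<lambda>s. f s (u s))" by simp
  \<comment> \<open>Pass to the limit in the integral equation by dominated convergence, with the
    constant \<open>M\<close> as dominating function.\<close>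
  have ueq: "u t = x0 + integral {0..t} (\<lambda>s. f s (u s))" if t: "t \<in> {0..1}" for t
  proof -
    have "(\<lambda>n. integral {0..t} (?h (k n))) \<longlonglongrightarrow> integral {0..t} (\<lambda>s. f s (u s))"
    proof (rule dominated_convergence(2)[where h="\<lambda>_. M"])
      show "?h (k n) integrable_on {0..t}" for n
        using continuous_on_subset[OF continuous_on_delayed_rhs[OF cont Ycont \<tau>], of "{0..t}"] t
        by (intro integrable_continuous_real) auto
    qed (use t bd limf in auto)
    then have "(\<lambda>n. Y (k n) t) \<longlonglongrightarrow> x0 + integral {0..t} (\<lambda>s. f s (u s))"
      using Yeq[OF t] by (auto intro!: tendsto_intros)
    then show ?thesis using lim[OF t] LIMSEQ_unique by blast
  qed
  show ?thesis
  proof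
    show "u 0 = x0" using ueq[of 0] by simp
    fix t :: real assume t: "t \<in> {0..1}"
    have "((\<lambda>t. x0 + integral {0..t} (\<lambda>s. f s (u s))) has_vector_derivative 0 + f t (u t))
        (at t within {0..1})"
      by (intro has_vector_derivative_add has_vector_derivative_const
          integral_has_vector_derivative[OF ucont t])
    then show "(u has_vector_derivative f t (u t)) (at t within {0..1})"
      using has_vector_derivative_transform[OF t ueq] by simp
  qed
qed

section \<open>Flows of time-dependent fields and their short-time expansion\<close>

lemma abs_continuous_curve_Lipschitz:
  assumes "\<And>s t. s \<in> {0..1} \<Longrightarrow> t \<in> {0..1} \<Longrightarrow> norm (u t - u s) \<le> M * \<bar>t - s\<bar>"
  shows "abs_continuous_curve u"
  unfolding abs_continuous_curve_def
proof (intro allI impI)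
  fix \<epsilon> :: real assume \<epsilon>: "\<epsilon> > 0"
  have M: "M \<ge> 0" using order_trans[OF norm_ge_zero assms[of 0 1]] by simp
  show "\<exists>\<delta>>0. \<forall>P. finite P \<and> (\<forall>(a, b)\<in>P. 0 \<le> a \<and> a \<le> b \<and> b \<le> 1) \<and>
     disjoint_family_on (\<lambda>(a, b). {a<..<b}) P \<and> (\<Sum>(a, b)\<in>P. b - a) < \<delta>
     \<longrightarrow> (\<Sum>(a, b)\<in>P. norm (u b - u a)) < \<epsilon>"
  proof (intro exI[of _ "\<epsilon> / (M + 1)"] conjI allI impI; (elim conjE)?)
    show "\<epsilon> / (M + 1) > 0" using \<epsilon> M by simp
    fix P :: "(real \<times> real) set"
    assume P: "\<forall>(a, b)\<in>P. 0 \<le> a \<and> a \<le> b \<and> b \<le> 1" "(\<Sum>(a, b)\<in>P. b - a) < \<epsilon> / (M + 1)"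
    have nn: "0 \<le> (\<Sum>(a, b)\<in>P. b - a)" using P(1) by (intro sum_nonneg) auto
    have "(\<Sum>(a, b)\<in>P. norm (u b - u a)) \<le> (\<Sum>(a, b)\<in>P. M * (b - a))"
    proof (rule sum_mono)
      fix p assume "p \<in> P"
      then have "fst p \<in> {0..1}" "snd p \<in> {0..1}" "fst p \<le> snd p"
        using P(1) by (auto simp: case_prod_unfold)
      then show "(case p of (a, b) \<Rightarrow> norm (u b - u a)) \<le> (case p of (a, b) \<Rightarrow> M * (b - a))"
        using assms[of "fst p" "snd p"] by (simp add: case_prod_unfold)
    qed
    also have "\<dots> = M * (\<Sum>(a, b)\<in>P. b - a)"
      by (simp add: sum_distrib_left case_prod_unfold)
    also have "\<dots> \<le> (M + 1) * (\<Sum>(a, b)\<in>P. b - a)" using nn by (simp add: mult_right_mono)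
    also have "\<dots> < \<epsilon>" using P(2) M by (simp add: field_simps)
    finally show "(\<Sum>(a, b)\<in>P. norm (u b - u a)) < \<epsilon>" .
  qed
qed

text \<open>A Lipschitz bound in space is available only at time \<open>0\<close>, so the flow need not be unique;
  any solution satisfies the two estimates.\<close>

lemma flow_solution_exists:
  fixes v :: "real \<Rightarrow> 'a::euclidean_space \<Rightarrow> 'a"
  assumes cont: "\<And>t. t \<in> {0..1} \<Longrightarrow> continuous_on UNIV (v t)"
    and Lip_t: "\<And>s t x. s \<in> {0..1} \<Longrightarrow> t \<in> {0..1} \<Longrightarrow> norm (v t x - v s x) \<le> c * \<bar>t - s\<bar>"
    and b: "\<And>x. norm (v 0 x) \<le> b" and Lip_0: "\<And>x y. norm (v 0 x - v 0 y) \<le> b * norm (x - y)"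
  obtains \<phi> where "flow_solution \<Omega> v \<phi>"
    and "\<And>t x. t \<in> {0..1} \<Longrightarrow> norm (\<phi> t x - x) \<le> (b + c) * t"
    and "\<And>t x. t \<in> {0..1} \<Longrightarrow> norm (\<phi> t x - x - t *\<^sub>R v 0 x) \<le> (c + b * (b + c)) * t\<^sup>2"
proof -
  have b0: "b \<ge> 0" by (rule order_trans[OF norm_ge_zero b])
  have c0: "c \<ge> 0" using order_trans[OF norm_ge_zero Lip_t[of 0 1 0]] by simp
  \<comment> \<open>Near \<open>(t, x)\<close> the increment splits into one in time, small
    uniformly in space by \<open>Lip_t\<close>, and one in space at the fixed time
    \<open>t\<close>.\<close>
  have joint: "continuous_on ({0..1} \<times> UNIV) (\<lambda>(t, x). v t x)"
    unfolding continuous_on_def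
  proof
    fix p assume "p \<in> {0..1::real} \<times> (UNIV :: 'a set)"
    then obtain t x where p: "p = (t, x)" "t \<in> {0..1}" by auto
    let ?F = "at p within {0..1} \<times> (UNIV :: 'a set)"
    have fst: "(fst \<longlongrightarrow> t) ?F" and snd: "(snd \<longlongrightarrow> x) ?F"
      using tendsto_fst[OF tendsto_ident_at] tendsto_snd[OF tendsto_ident_at] p(1) by force+
    have "((\<lambda>q. v t (snd q)) \<longlongrightarrow> v t x) ?F"
      using continuous_on_tendsto_compose[OF cont[OF p(2)] snd] by simp
    moreover have "((\<lambda>q. v (fst q) (snd q) - v t (snd q)) \<longlongrightarrow> 0) ?F"
    proof (rule Lim_null_comparison)
      show "\<forall>\<^sub>F q in ?F. norm (v (fst q) (snd q) - v t (snd q)) \<le> c * \<bar>fst q - t\<bar>"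
        unfolding eventually_at_filter
        by (intro always_eventually) (auto simp: mem_Times_iff intro!: Lip_t[OF p(2)])
      show "((\<lambda>q. c * \<bar>fst q - t\<bar>) \<longlongrightarrow> 0) ?F"
        using tendsto_mult_right_zero[OF tendsto_rabs_zero[OF LIM_zero[OF fst]]] .
    qed
    ultimately have "((\<lambda>q. v (fst q) (snd q)) \<longlongrightarrow> v t x) ?F"
      by (rule Lim_transform)
    then show "((\<lambda>(t, x). v t x) \<longlongrightarrow> (case p of (t, x) \<Rightarrow> v t x)) ?F"
      by (simp add: p case_prod_unfold)
  qed
  have bd: "norm (v t x) \<le> b + c" if "t \<in> {0..1}" for t x
  proof -
    have "norm (v t x) \<le> norm (v 0 x) + norm (v t x - v 0 x)" by (metis norm_triangle_sub)
    also have "\<dots> \<le> b + c * \<bar>t - 0\<bar>" using b Lip_t[of 0 t x] that by (intro add_mono) auto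
    also have "\<dots> \<le> b + c" using that c0 by (simp add: mult_left_le)
    finally show ?thesis .
  qed
  have "\<exists>u. u 0 = x \<and> (\<forall>t\<in>{0..1}. (u has_vector_derivative v t (u t)) (at t within {0..1}))" for x
    using Peano_existence[OF joint bd] by metis
  then obtain u where u0: "\<And>x. u x 0 = x"
    and u: "\<And>x t. t \<in> {0..1} \<Longrightarrow> (u x has_vector_derivative v t (u x t)) (at t within {0..1})"
    by metis
  have uLip: "norm (u x t - u x s) \<le> (b + c) * \<bar>t - s\<bar>" if "s \<in> {0..1}" "t \<in> {0..1}" for s t x
    by (rule vector_derivative_bound_Lipschitz[OF _ u]) (use that bd in auto)
  have est1: "norm (u x t - x) \<le> (b + c) * t" if "t \<in> {0..1}" for t x
    using uLip[of 0 t x] that u0 by simp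
  have est2: "norm (u x t - x - t *\<^sub>R v 0 x) \<le> (c + b * (b + c)) * t\<^sup>2" if t: "t \<in> {0..1}" for t x
  proof -
    \<comment> \<open>The mean value inequality is applied to the curve minus its initial linear
      part. The derivative is split at \<open>v 0 (u x s)\<close>, so that the spatial Lipschitz
      bound enters at time 0 only; it is of order \<open>t\<close>, and the length of the interval
      gives the second factor \<open>t\<close>.\<close>
    have "norm ((u x t - t *\<^sub>R v 0 x) - (u x 0 - 0 *\<^sub>R v 0 x)) \<le> ((c + b * (b + c)) * t) * \<bar>t - 0\<bar>"
    proof (rule vector_derivative_bound_Lipschitz[where I="{0..t}" and u="\<lambda>s. u x s - s *\<^sub>R v 0 x"
          and u'="\<lambda>s. v s (u x s) - v 0 x"])
      fix s assume s: "s \<in> {0..t}"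
      then have s1: "s \<in> {0..1}" using t by auto
      have "(u x has_vector_derivative v s (u x s)) (at s within {0..t})"
        by (rule has_vector_derivative_within_subset[OF u[OF s1]]) (use t in auto)
      moreover have "((\<lambda>s. s *\<^sub>R v 0 x) has_vector_derivative v 0 x) (at s within {0..t})"
        by (auto intro!: derivative_eq_intros)
      ultimately show "((\<lambda>s. u x s - s *\<^sub>R v 0 x) has_vector_derivative v s (u x s) - v 0 x) (at s within {0..t})"
        by (rule has_vector_derivative_diff)
      have "v s (u x s) - v 0 x = (v s (u x s) - v 0 (u x s)) + (v 0 (u x s) - v 0 x)" by simp
      also have "norm \<dots> \<le> c * \<bar>s - 0\<bar> + b * norm (u x s - x)"
        using s1 by (intro norm_triangle_mono Lip_t Lip_0) auto
      also have "\<dots> \<le> c * s + b * ((b + c) * s)"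
        using est1[OF s1, of x] b0 c0 s1 by (intro add_mono mult_left_mono) auto
      also have "\<dots> = (c + b * (b + c)) * s" by (simp add: algebra_simps)
      also have "\<dots> \<le> (c + b * (b + c)) * t"
        using s b0 c0 by (intro mult_left_mono) auto
      finally show "norm (v s (u x s) - v 0 x) \<le> (c + b * (b + c)) * t" .
    qed (use t in auto)
    also have "((c + b * (b + c)) * t) * \<bar>t - 0\<bar> = (c + b * (b + c)) * t\<^sup>2"
      using t by (simp add: power2_eq_square)
    finally show ?thesis using u0 by (simp add: algebra_simps)
  qed
  have "flow_solution \<Omega> v (\<lambda>t x. u x t)"
    unfolding flow_solution_def
  proof (intro conjI ballI)
    show "abs_continuous_curve (u x)" for x
      by (rule abs_continuous_curve_Lipschitz[OF uLip])
    \<comment> \<open>The null set of exceptional times must be common to all \<open>x\<close>; here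
      it is empty, since the right-hand side is continuous.\<close>
    show "AE t in lborel. t \<in> {0..1} \<longrightarrow>
        (\<forall>x\<in>\<Omega>. (u x has_vector_derivative v t (u x t)) (at t within {0..1}))"
      using u by (intro AE_I2) blast
  qed (rule u0)
  then show ?thesis using that est1 est2 by blast
qed

section \<open>Transport maps\<close>

text \<open>The library defines \<^const>\<open>distr\<close> also for non-measurable maps, but then it is not a probability
  measure: a non-measurable preimage has \<^const>\<open>emeasure\<close> \<open>0\<close> by convention, and so has its
  complement.\<close>

lemma measurable_if_prob_space_distr:
  assumes "prob_space (distr M N f)" "f \<in> space M \<rightarrow> space N"
  shows "f \<in> measurable M N"
proof (rule measurableI)
  interpret prob_space "distr M N f" by fact
  let ?\<mu> = "\<lambda>A. emeasure M (f -` A \<inter> space M)"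
  have "emeasure (distr M N f) (space N) = 1"
    using emeasure_space_1 by simp
  \<comment> \<open>\<open>measure_of\<close> falls back to the zero measure when the given set
    function is not a measure; total mass 1 excludes this.\<close>
  then have "measure_space (space N) (sigma_sets (space N) (sets N)) ?\<mu>"
    unfolding distr_def emeasure_measure_of_conv by (metis zero_neq_one)
  then have eq: "emeasure (distr M N f) B = ?\<mu> B" if "B \<in> sets N" for B
    using that unfolding distr_def emeasure_measure_of_conv by (simp add: sets.sigma_sets_eq)
  fix B assume B: "B \<in> sets N"
  show "f -` B \<inter> space M \<in> sets M"
  proof (rule ccontr)
    assume no: "f -` B \<inter> space M \<notin> sets M"
    have "space M - (f -` (space N - B) \<inter> space M) = f -` B \<inter> space M"
      using assms(2) by auto
    then have no': "f -` (space N - B) \<inter> space M \<notin> sets M"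
      using no by (metis sets.compl_sets)
    have "prob B = 0" "prob (space N - B) = 0"
      using eq[OF B] eq[of "space N - B"] B no no' by (auto simp: emeasure_notin_sets measure_def)
    then show False using prob_compl[of B] B by simp
  qed
qed (use assms(2) in auto)

text \<open>The mean value theorem on the segment gives the gradient at an intermediate point;
  moving it back to \<open>x\<close> costs \<open>M * norm (y - x)\<close>. Compared with the
  integral form of the remainder this loses a factor 2, which affects constants only.\<close>

lemma C1_gradient_remainder:
  fixes v :: "'a::euclidean_space \<Rightarrow> 'a"
  assumes grad: "\<And>x. GDERIV \<psi> x :> v x" and Lip: "\<And>x y. norm (v x - v y) \<le> M * norm (x - y)"
  shows "\<bar>\<psi> y - \<psi> x - v x \<bullet> (y - x)\<bar> \<le> M * (norm (y - x))\<^sup>2"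
proof -
  \<comment> \<open>A basis vector has norm 1, so the Lipschitz inequality between it and 0 fixes
    the sign of \<open>M\<close>.\<close>
  have M: "M \<ge> 0"
    using order_trans[OF norm_ge_zero Lip[of "SOME b. b \<in> Basis" 0]] by (simp add: some_in_eq norm_Basis)
  let ?g = "\<lambda>s. x + s *\<^sub>R (y - x)"
  have "((\<lambda>s. \<psi> (?g s)) has_derivative (\<lambda>h. (h *\<^sub>R (y - x)) \<bullet> v (?g s))) (at s within {0..1})" for s :: real
    by (rule has_derivative_compose[where g=\<psi> and f="?g"])
      (use grad in \<open>auto simp: gderiv_def intro!: derivative_eq_intros\<close>)
  from mvt_very_simple[OF zero_le_one this]
  obtain s where s: "s \<in> {0..1}" and eq: "\<psi> y - \<psi> x = (y - x) \<bullet> v (?g s)" by auto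
  have "\<bar>\<psi> y - \<psi> x - v x \<bullet> (y - x)\<bar> = \<bar>(y - x) \<bullet> (v (?g s) - v x)\<bar>"
    using eq by (simp add: inner_diff_right inner_commute)
  also have "\<dots> \<le> norm (y - x) * norm (v (?g s) - v x)" by (rule Cauchy_Schwarz_ineq2)
  also have "\<dots> \<le> norm (y - x) * (M * norm (?g s - x))" by (intro mult_left_mono Lip) auto
  also have "\<dots> \<le> norm (y - x) * (M * norm (y - x))"
    using s M by (intro mult_left_mono) (auto simp: mult_left_le_one_le)
  finally show ?thesis by (simp add: power2_eq_square algebra_simps)
qed

lemma (in finite_measure) integrable_continuous_compact:
  fixes F :: "'b::topological_space \<Rightarrow> real"
  assumes F: "continuous_on UNIV F" and X: "X \<in> borel_measurable M"
    and K: "compact K" "AE x in M. X x \<in> K"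
  shows "integrable M (\<lambda>x. F (X x))"
proof -
  have compact: "compact (F ` K)"
    by (rule compact_continuous_image[OF continuous_on_subset[OF F] K(1)]) simp
  then obtain b where b: "\<And>y. y \<in> K \<Longrightarrow> norm (F y) \<le> b"
    using compact_imp_bounded[OF compact] by (auto simp: bounded_iff)
  have "AE x in M. norm (F (X x)) \<le> b"
    using K(2) by eventually_elim (rule b)
  then show ?thesis
    using measurable_compose[OF X borel_measurable_continuous_onI[OF F]]
    by (rule integrable_const_bound)
qed

text \<open>Both transport maps change the integral of the potential \<open>\<psi>\<close> by the same amount, which is
  the pairing of the displacement with \<open>v = \<nabla>\<psi>\<close> up to a quadratic error. As \<open>T\<close> is cheaper than
  \<open>F\<close>, it is therefore nearly as close to \<open>id + t v\<close> as \<open>F\<close> is.\<close>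

lemma cheaper_transport_near_gradient:
  fixes \<mu> :: "'a::euclidean_space measure"
  assumes "prob_space \<mu>" and sets: "sets \<mu> = sets borel" and "compact \<Omega>"
    and grad: "\<And>x. GDERIV \<psi> x :> v x" and Lip: "\<And>x y. norm (v x - v y) \<le> M * norm (x - y)"
    and T: "T \<in> borel_measurable \<mu>" and F: "F \<in> borel_measurable \<mu>"
    and push: "distr \<mu> borel T = distr \<mu> borel F"
    and AE: "AE x in \<mu>. x \<in> \<Omega>" "AE x in \<mu>. T x \<in> \<Omega>" "AE x in \<mu>. F x \<in> \<Omega>"
    and cost: "(\<integral>\<^sup>+x. ennreal ((norm (x - T x))\<^sup>2) \<partial>\<mu>) \<le> (\<integral>\<^sup>+x. ennreal ((norm (x - F x))\<^sup>2) \<partial>\<mu>)"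
    and t: "t \<ge> 0"
    and a: "\<And>x. x \<in> \<Omega> \<Longrightarrow> norm (F x - x - t *\<^sub>R v x) \<le> a"
    and b: "\<And>x. x \<in> \<Omega> \<Longrightarrow> norm (F x - x) \<le> b"
  shows "(\<integral>x. (norm (T x - x - t *\<^sub>R v x))\<^sup>2 \<partial>\<mu>) \<le> a\<^sup>2 + 4 * t * M * b\<^sup>2"
proof -
  interpret prob_space \<mu> by fact
  have M: "M \<ge> 0"
    using order_trans[OF norm_ge_zero Lip[of "SOME b. b \<in> Basis" 0]] by (simp add: some_in_eq norm_Basis)
  have contv: "continuous_on UNIV v"
    using lipschitz_on_continuous_on[OF lipschitz_onI[of UNIV v M]] Lip M by (auto simp: dist_norm)
  have cont\<psi>: "continuous_on UNIV \<psi>"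
    using grad unfolding gderiv_def
    by (intro has_derivative_continuous_on) (auto intro: has_derivative_at_withinI)
  have contv': "continuous_on UNIV (\<lambda>p :: 'a \<times> 'a. v (fst p))"
    by (rule continuous_on_compose2[OF contv]) (auto intro: continuous_intros)
  have cont\<psi>': "continuous_on UNIV (\<lambda>p :: 'a \<times> 'a. \<psi> (fst p))"
    "continuous_on UNIV (\<lambda>p :: 'a \<times> 'a. \<psi> (snd p))"
    by (rule continuous_on_compose2[OF cont\<psi>]; auto intro: continuous_intros)+
  \<comment> \<open>Every integrand below is a continuous function of the pair
    \<open>(x, Y x)\<close>, which almost surely lies in the compact set
    \<open>\<Omega> \<times> \<Omega>\<close>.\<close>
  have int: "integrable \<mu> (\<lambda>x. G (x, Y x))"
    if "continuous_on UNIV G" "Y \<in> borel_measurable \<mu>" "AE x in \<mu>. Y x \<in> \<Omega>"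
    for G :: "'a \<times> 'a \<Rightarrow> real" and Y
  proof -
    have "(\<lambda>x. (x, Y x)) \<in> borel_measurable \<mu>"
      using that(2) sets by (intro borel_measurable_Pair) (auto simp: measurable_ident_sets)
    from integrable_continuous_compact[OF that(1) this compact_Times[OF \<open>compact \<Omega>\<close> \<open>compact \<Omega>\<close>]]
    show ?thesis using AE(1) that(3) by auto
  qed
  have i1: "integrable \<mu> (\<lambda>x. (norm (Y x - x))\<^sup>2)" "integrable \<mu> (\<lambda>x. v x \<bullet> (Y x - x))"
    "integrable \<mu> (\<lambda>x. (norm (v x))\<^sup>2)" "integrable \<mu> (\<lambda>x. \<psi> (Y x))" "integrable \<mu> (\<lambda>x. \<psi> x)"
    "integrable \<mu> (\<lambda>x. (norm (Y x - x - t *\<^sub>R v x))\<^sup>2)"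
    if "Y \<in> borel_measurable \<mu>" "AE x in \<mu>. Y x \<in> \<Omega>" for Y
  proof -
    have "continuous_on UNIV (\<lambda>p :: 'a \<times> 'a. (norm (snd p - fst p))\<^sup>2)"
      "continuous_on UNIV (\<lambda>p :: 'a \<times> 'a. v (fst p) \<bullet> (snd p - fst p))"
      "continuous_on UNIV (\<lambda>p :: 'a \<times> 'a. (norm (v (fst p)))\<^sup>2)"
      "continuous_on UNIV (\<lambda>p :: 'a \<times> 'a. (norm (snd p - fst p - t *\<^sub>R v (fst p)))\<^sup>2)"
      by (intro continuous_intros contv')+
    note this(1,2,3)[THEN int, OF that] cont\<psi>'(2,1)[THEN int, OF that] this(4)[THEN int, OF that]
    then show "integrable \<mu> (\<lambda>x. (norm (Y x - x))\<^sup>2)" "integrable \<mu> (\<lambda>x. v x \<bullet> (Y x - x))"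
      "integrable \<mu> (\<lambda>x. (norm (v x))\<^sup>2)" "integrable \<mu> (\<lambda>x. \<psi> (Y x))" "integrable \<mu> (\<lambda>x. \<psi> x)"
      "integrable \<mu> (\<lambda>x. (norm (Y x - x - t *\<^sub>R v x))\<^sup>2)"
      unfolding fst_conv snd_conv .
  qed
  note iT = i1[OF T AE(2)] and iF = i1[OF F AE(3)]
  have remainder: "\<bar>\<psi> y - \<psi> x - v x \<bullet> (y - x)\<bar> \<le> M * (norm (y - x))\<^sup>2" for x y
    by (rule C1_gradient_remainder[OF grad Lip])
  have expand: "(norm (y - x - t *\<^sub>R v x))\<^sup>2 = (norm (y - x))\<^sup>2 - 2 * t * (v x \<bullet> (y - x)) + t\<^sup>2 * (norm (v x))\<^sup>2" for x y
    unfolding power2_norm_eq_inner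
    by (simp add: inner_diff_left inner_diff_right inner_commute algebra_simps power2_eq_square del: dot_square_norm)
  have cost': "(\<integral>x. (norm (T x - x))\<^sup>2 \<partial>\<mu>) \<le> (\<integral>x. (norm (F x - x))\<^sup>2 \<partial>\<mu>)"
    using cost nn_integral_eq_integral[OF iT(1)] nn_integral_eq_integral[OF iF(1)]
    by (simp add: norm_minus_commute ennreal_le_iff integral_nonneg_AE)
  have push': "(\<integral>x. \<psi> (T x) \<partial>\<mu>) = (\<integral>x. \<psi> (F x) \<partial>\<mu>)"
    using integral_distr[OF T, of \<psi>] integral_distr[OF F, of \<psi>] push
      borel_measurable_continuous_onI[OF cont\<psi>] by simp
  \<comment> \<open>Trading the cross term for the potential difference costs
    \<open>2 * t * M\<close> times the squared displacement. What is left depends on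
    \<open>T\<close> only through its cost and its push-forward.\<close>
  have "(\<integral>x. (norm (T x - x - t *\<^sub>R v x))\<^sup>2 \<partial>\<mu>)
      \<le> (\<integral>x. (1 + 2 * t * M) * (norm (T x - x))\<^sup>2 - 2 * t * (\<psi> (T x) - \<psi> x) + t\<^sup>2 * (norm (v x))\<^sup>2 \<partial>\<mu>)"
  proof (rule integral_mono)
    fix x
    have "t * (\<psi> (T x) - \<psi> x - v x \<bullet> (T x - x)) \<le> t * (M * (norm (T x - x))\<^sup>2)"
      using remainder[of "T x" x] t by (intro mult_left_mono) auto
    then show "(norm (T x - x - t *\<^sub>R v x))\<^sup>2 \<le> (1 + 2 * t * M) * (norm (T x - x))\<^sup>2
        - 2 * t * (\<psi> (T x) - \<psi> x) + t\<^sup>2 * (norm (v x))\<^sup>2"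
      unfolding expand by (simp add: algebra_simps)
  qed (use iT in auto)
  also have "\<dots> = (1 + 2 * t * M) * (\<integral>x. (norm (T x - x))\<^sup>2 \<partial>\<mu>)
      - 2 * t * ((\<integral>x. \<psi> (T x) \<partial>\<mu>) - (\<integral>x. \<psi> x \<partial>\<mu>)) + t\<^sup>2 * (\<integral>x. (norm (v x))\<^sup>2 \<partial>\<mu>)"
    using iT by simp
  \<comment> \<open>Now \<open>T\<close> can be replaced by \<open>F\<close>: the potential terms
    agree by \<open>push'\<close>, and the cost has a nonnegative coefficient.\<close>
  also have "\<dots> \<le> (1 + 2 * t * M) * (\<integral>x. (norm (F x - x))\<^sup>2 \<partial>\<mu>)
      - 2 * t * ((\<integral>x. \<psi> (F x) \<partial>\<mu>) - (\<integral>x. \<psi> x \<partial>\<mu>)) + t\<^sup>2 * (\<integral>x. (norm (v x))\<^sup>2 \<partial>\<mu>)"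
    unfolding push' using mult_left_mono[OF cost', of "1 + 2 * t * M"] t M by auto
  also have "\<dots> = (\<integral>x. (1 + 2 * t * M) * (norm (F x - x))\<^sup>2 - 2 * t * (\<psi> (F x) - \<psi> x) + t\<^sup>2 * (norm (v x))\<^sup>2 \<partial>\<mu>)"
    using iF by simp
  also have "\<dots> \<le> (\<integral>x. a\<^sup>2 + 4 * t * M * b\<^sup>2 \<partial>\<mu>)"
  proof (rule integral_mono_AE)
    show "AE x in \<mu>. (1 + 2 * t * M) * (norm (F x - x))\<^sup>2 - 2 * t * (\<psi> (F x) - \<psi> x) + t\<^sup>2 * (norm (v x))\<^sup>2
      \<le> a\<^sup>2 + 4 * t * M * b\<^sup>2"
      using AE(1)
    proof eventually_elim
      fix x assume x: "x \<in> \<Omega>"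
      \<comment> \<open>Returning from the potential to the cross term, now for \<open>F\<close>,
        uses the other sign of the remainder and costs another \<open>2 * t * M\<close>; hence the
        factor 4.\<close>
      have "t * (v x \<bullet> (F x - x) - (\<psi> (F x) - \<psi> x)) \<le> t * (M * (norm (F x - x))\<^sup>2)"
        using remainder[of "F x" x] t by (intro mult_left_mono) auto
      then have "(1 + 2 * t * M) * (norm (F x - x))\<^sup>2 - 2 * t * (\<psi> (F x) - \<psi> x) + t\<^sup>2 * (norm (v x))\<^sup>2
          \<le> (norm (F x - x - t *\<^sub>R v x))\<^sup>2 + 4 * t * M * (norm (F x - x))\<^sup>2"
        unfolding expand by (simp add: algebra_simps)
      also have "\<dots> \<le> a\<^sup>2 + 4 * t * M * b\<^sup>2"
        using a[OF x] b[OF x] t M by (intro add_mono mult_left_mono power_mono) auto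
      finally show "(1 + 2 * t * M) * (norm (F x - x))\<^sup>2 - 2 * t * (\<psi> (F x) - \<psi> x) + t\<^sup>2 * (norm (v x))\<^sup>2
          \<le> a\<^sup>2 + 4 * t * M * b\<^sup>2" .
    qed
  qed (use iF in auto)
  finally show ?thesis by (simp add: prob_space)
qed

section \<open>Measures on a compact set, couplings and competitors\<close>

lemma AE_prob_measures_on:
  assumes "compact \<Omega>" "\<mu> \<in> prob_measures_on \<Omega>"
  shows "AE x in \<mu>. x \<in> \<Omega>"
proof -
  interpret prob_space \<mu> using assms by (simp add: prob_measures_on_def)
  have "\<Omega> \<in> sets \<mu>" using assms by (auto simp: prob_measures_on_def intro: borel_compact)
  moreover have "prob \<Omega> = 1" using assms by (simp add: prob_measures_on_def measure_def)
  ultimately show ?thesis by (simp add: AE_in_set_eq_1)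
qed

text \<open>Every coupling is concentrated on \<open>\<Omega> \<times> \<Omega>\<close>, where the
  cost is at most \<open>d\<close> squared. This will bound the tangent norms on \<open>D\<close>
  uniformly.\<close>

lemma wasserstein_le_diameter:
  assumes \<Omega>: "compact \<Omega>" and \<mu>: "\<mu> \<in> prob_measures_on \<Omega>" and \<nu>: "\<nu> \<in> prob_measures_on \<Omega>"
    and d: "\<And>x y. x \<in> \<Omega> \<Longrightarrow> y \<in> \<Omega> \<Longrightarrow> norm (x - y) \<le> d" "d \<ge> 0"
  shows "wasserstein \<mu> \<nu> \<le> d"
proof -
  have "transport_cost \<pi> \<le> ennreal (d\<^sup>2)" if \<pi>: "\<pi> \<in> couplings \<mu> \<nu>" for \<pi>
  proof -
    have s: "sets \<pi> = sets (borel \<Otimes>\<^sub>M borel)"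
      and distr: "distr \<pi> borel fst = \<mu>" "distr \<pi> borel snd = \<nu>"
      using \<pi> by (simp_all add: couplings_def)
    have m: "fst \<in> measurable \<pi> borel" "snd \<in> measurable \<pi> borel"
      unfolding measurable_cong_sets[OF s refl] by (rule measurable_fst measurable_snd)+
    \<comment> \<open>A coupling has total mass 1 because its first marginal does.\<close>
    interpret prob_space \<pi>
      using prob_space_distrD[OF m(1)] distr \<mu> by (simp add: prob_measures_on_def)
    have "AE p in \<pi>. fst p \<in> \<Omega>" "AE p in \<pi>. snd p \<in> \<Omega>"
      using AE_prob_measures_on[OF \<Omega> \<mu>] AE_prob_measures_on[OF \<Omega> \<nu>] AE_distr_iff[OF m(1), of "\<lambda>x. x \<in> \<Omega>"]
        AE_distr_iff[OF m(2), of "\<lambda>x. x \<in> \<Omega>"] distr borel_compact[OF \<Omega>] by auto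
    then have "AE p in \<pi>. (case p of (x, y) \<Rightarrow> ennreal ((norm (x - y))\<^sup>2)) \<le> ennreal (d\<^sup>2)"
    proof eventually_elim
      case (elim p)
      then show ?case using d by (auto simp: case_prod_unfold intro!: ennreal_leI power_mono)
    qed
    then have "transport_cost \<pi> \<le> (\<integral>\<^sup>+p. ennreal (d\<^sup>2) \<partial>\<pi>)"
      unfolding transport_cost_def by (rule nn_integral_mono_AE)
    then show ?thesis by (simp add: emeasure_space_1)
  qed
  \<comment> \<open>Over an empty set of couplings the infimum is \<infinity>, which
    \<open>enn2real\<close> sends to 0, so the bound holds in that case too.\<close>
  then have "enn2real (INF \<pi>\<in>couplings \<mu> \<nu>. transport_cost \<pi>) \<le> d\<^sup>2"
  proof (cases "couplings \<mu> \<nu> = {}")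
    case False
    then obtain \<pi> where "\<pi> \<in> couplings \<mu> \<nu>" by blast
    then have "(INF \<pi>\<in>couplings \<mu> \<nu>. transport_cost \<pi>) \<le> ennreal (d\<^sup>2)"
      using \<open>\<And>\<pi>. \<pi> \<in> couplings \<mu> \<nu> \<Longrightarrow> transport_cost \<pi> \<le> ennreal (d\<^sup>2)\<close> by (meson INF_lower2)
    then show ?thesis by (rule enn2real_leI[rotated]) simp
  qed simp
  then show ?thesis
    unfolding wasserstein_def using d(2) by (metis real_sqrt_le_mono real_sqrt_abs abs_of_nonneg)
qed

text \<open>The flow map makes sense on \<open>\<Omega>\<close> only. Filling in the identity on the
  null set outside gives a map on the whole space with the same push-forward, which can compete with
  the optimal map.\<close>

lemma pushforward_extend:
  assumes \<Omega>: "compact \<Omega>" and \<mu>: "\<mu> \<in> prob_measures_on \<Omega>" and \<nu>: "\<nu> \<in> prob_measures_on \<Omega>"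
    and distr: "\<nu> = distr (restrict_space \<mu> \<Omega>) borel f"
  defines "F \<equiv> \<lambda>x. if x \<in> \<Omega> then f x else x"
  shows "F \<in> borel_measurable \<mu>" and "distr \<mu> borel F = \<nu>"
proof -
  have s\<mu>: "sets \<mu> = sets borel" and s\<nu>: "sets \<nu> = sets borel" and p\<nu>: "prob_space \<nu>"
    using \<mu> \<nu> by (auto simp: prob_measures_on_def)
  have sp: "space \<mu> = UNIV" using sets_eq_imp_space_eq[OF s\<mu>] by simp
  have \<Omega>s: "\<Omega> \<in> sets \<mu>" using borel_compact[OF \<Omega>] s\<mu> by simp
  have f: "f \<in> measurable (restrict_space \<mu> \<Omega>) borel"
    by (rule measurable_if_prob_space_distr) (use p\<nu> distr in auto)
  have "(\<lambda>x. x) \<in> borel_measurable \<mu>" using s\<mu> by (simp add: measurable_ident_sets)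
  then show F: "F \<in> borel_measurable \<mu>"
    unfolding F_def using f \<Omega>s sp
    by (subst measurable_If_restrict_space_iff) (auto intro: measurable_restrict_space1)
  show "distr \<mu> borel F = \<nu>"
  proof (rule measure_eqI)
    fix X assume "X \<in> sets (distr \<mu> borel F)"
    then have X: "X \<in> sets borel" by simp
    have fX: "f -` X \<inter> \<Omega> \<in> sets \<mu>"
      using measurable_sets[OF f X] \<Omega>s sp by (simp add: space_restrict_space sets_restrict_space_iff)
    have "emeasure (distr \<mu> borel F) X = emeasure \<mu> (F -` X \<inter> space \<mu>)"
      by (rule emeasure_distr[OF F X])
    also have "\<dots> = emeasure \<mu> (f -` X \<inter> \<Omega>)"
    proof (rule emeasure_eq_AE)
      show "AE x in \<mu>. (x \<in> F -` X \<inter> space \<mu>) = (x \<in> f -` X \<inter> \<Omega>)"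
        using AE_prob_measures_on[OF \<Omega> \<mu>] by eventually_elim (simp add: F_def sp)
    qed (use fX measurable_sets[OF F X] in auto)
    also have "\<dots> = emeasure (restrict_space \<mu> \<Omega>) (f -` X \<inter> space (restrict_space \<mu> \<Omega>))"
      using \<Omega>s sp by (subst emeasure_restrict_space) (auto simp: space_restrict_space)
    also have "\<dots> = emeasure \<nu> X"
      unfolding distr by (rule emeasure_distr[OF f X, symmetric])
    finally show "emeasure (distr \<mu> borel F) X = emeasure \<nu> X" .
  qed (simp add: s\<nu>)
qed

lemma graph_coupling:
  fixes F :: "'a::euclidean_space \<Rightarrow> 'a"
  assumes "sets \<mu> = sets borel" and F: "F \<in> borel_measurable \<mu>"
  defines "\<pi> \<equiv> distr \<mu> (borel \<Otimes>\<^sub>M borel) (\<lambda>x. (x, F x))"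
  shows "distr \<pi> borel fst = \<mu>" and "distr \<pi> borel snd = distr \<mu> borel F"
    and "transport_cost \<pi> = (\<integral>\<^sup>+x. ennreal ((norm (x - F x))\<^sup>2) \<partial>\<mu>)"
proof -
  have m: "(\<lambda>x. (x, F x)) \<in> measurable \<mu> (borel \<Otimes>\<^sub>M borel)"
    using F assms(1) by (intro measurable_Pair) (auto simp: measurable_ident_sets)
  show "distr \<pi> borel fst = \<mu>"
    unfolding \<pi>_def using assms(1) by (subst distr_distr[OF _ m]) (auto simp: o_def distr_id2)
  show "distr \<pi> borel snd = distr \<mu> borel F"
    unfolding \<pi>_def by (subst distr_distr[OF _ m]) (auto simp: o_def)
  have "(\<lambda>p :: 'a \<times> 'a. ennreal ((norm (fst p - snd p))\<^sup>2)) \<in> borel_measurable (borel \<Otimes>\<^sub>M borel)"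
    by measurable
  then show "transport_cost \<pi> = (\<integral>\<^sup>+x. ennreal ((norm (x - F x))\<^sup>2) \<partial>\<mu>)"
    unfolding \<pi>_def transport_cost_def case_prod_unfold by (subst nn_integral_distr[OF m]) auto
qed

text \<open>Optimality is stated among plans; testing it with the plan carried by the graph of
  \<open>F\<close> gives the comparison between maps.\<close>

lemma optimal_map_cheapest:
  fixes T F :: "'a::euclidean_space \<Rightarrow> 'a"
  assumes s: "sets \<mu> = sets borel" and T: "optimal_map \<mu> \<nu> T"
    and F: "F \<in> borel_measurable \<mu>" "distr \<mu> borel F = \<nu>"
  shows "T \<in> borel_measurable \<mu>" and "distr \<mu> borel T = \<nu>"
    and "(\<integral>\<^sup>+x. ennreal ((norm (x - T x))\<^sup>2) \<partial>\<mu>) \<le> (\<integral>\<^sup>+x. ennreal ((norm (x - F x))\<^sup>2) \<partial>\<mu>)"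
proof -
  show mT: "T \<in> borel_measurable \<mu>" using T by (simp add: optimal_map_def)
  let ?\<pi> = "\<lambda>F. distr \<mu> (borel \<Otimes>\<^sub>M borel) (\<lambda>x. (x, F x))"
  have "?\<pi> T \<in> couplings \<mu> \<nu>" and opt: "\<And>\<pi>'. \<pi>' \<in> couplings \<mu> \<nu> \<Longrightarrow> transport_cost (?\<pi> T) \<le> transport_cost \<pi>'"
    using T unfolding optimal_map_def Let_def by auto
  then show "distr \<mu> borel T = \<nu>"
    using graph_coupling(2)[OF s mT] by (simp add: couplings_def)
  have "?\<pi> F \<in> couplings \<mu> \<nu>"
    using graph_coupling(1,2)[OF s F(1)] F(2) by (simp add: couplings_def)
  from opt[OF this] show "(\<integral>\<^sup>+x. ennreal ((norm (x - T x))\<^sup>2) \<partial>\<mu>) \<le> (\<integral>\<^sup>+x. ennreal ((norm (x - F x))\<^sup>2) \<partial>\<mu>)"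
    using graph_coupling(3)[OF s mT] graph_coupling(3)[OF s F(1)] by simp
qed

section \<open>Curves in Riemannian manifolds\<close>

lemma transition_differentiable:
  assumes "smooth_atlas A" "c \<in> charts_at A p" "c' \<in> charts_at A p"
  shows "transition c c' differentiable (at (snd c p))"
proof -
  have "smooth_on (snd c ` (fst c \<inter> fst c')) (transition c c')"
    using assms unfolding smooth_atlas_def charts_at_def by auto
  then have "Ck_on (Suc 0) (snd c ` (fst c \<inter> fst c')) (transition c c')"
    unfolding smooth_on_def by blast
  then show ?thesis using assms(2,3) by (auto simp: charts_at_def)
qed

lemma transition_chart:
  assumes "smooth_atlas A" "c \<in> A" "p \<in> fst c"
  shows "transition c c' (snd c p) = snd c' p"
proof -
  have "is_chart c" using assms unfolding smooth_atlas_def by auto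
  then have "chart_inv c (snd c p) = p"
    using assms(3) unfolding is_chart_def homeomorphism_def by auto
  then show ?thesis by (simp add: transition_def)
qed

lemma tangent_space_outside:
  "\<xi> \<in> tangent_space A p \<Longrightarrow> c \<notin> charts_at A p \<Longrightarrow> \<xi> c = 0"
  unfolding tangent_space_def by blast

lemma tscale_in_tangent_space:
  assumes "smooth_atlas A" "\<xi> \<in> tangent_space A p"
  shows "tscale a \<xi> \<in> tangent_space A p"
  unfolding tangent_space_def tscale_def
proof (intro CollectI conjI allI ballI impI)
  fix c assume "c \<notin> charts_at A p"
  then show "a *\<^sub>R \<xi> c = 0" using tangent_space_outside[OF assms(2)] by simp
next
  fix c c' assume c: "c \<in> charts_at A p" "c' \<in> charts_at A p"
  have "linear (frechet_derivative (transition c c') (at (snd c p)))"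
    using transition_differentiable[OF assms(1) c] by (rule linear_frechet_derivative)
  moreover have "\<xi> c' = frechet_derivative (transition c c') (at (snd c p)) (\<xi> c)"
    using assms(2) c unfolding tangent_space_def by blast
  ultimately show "a *\<^sub>R \<xi> c' = frechet_derivative (transition c c') (at (snd c p)) (a *\<^sub>R \<xi> c)"
    by (simp add: linear_cmul)
qed

lemma metric_tscale:
  assumes "riemannian_metric A g" "\<xi> \<in> tangent_space A p" "\<rho> \<in> tangent_space A p"
  shows "g p (tscale a \<xi>) \<rho> = a * g p \<xi> \<rho>"
proof -
  \<comment> \<open>Linearity is formulated for sums of two multiples, so the second coefficient is
    set to 0.\<close>
  have "g p (tadd (tscale a \<xi>) (tscale 0 \<xi>)) \<rho> = a * g p \<xi> \<rho> + 0 * g p \<xi> \<rho>"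
    using assms unfolding riemannian_metric_def by blast
  then show ?thesis by (simp add: tadd_def tscale_def)
qed

lemma metric_nonneg:
  assumes "riemannian_metric A g" "\<xi> \<in> tangent_space A p"
  shows "g p \<xi> \<xi> \<ge> 0"
proof (cases "\<xi> = (\<lambda>_. 0)")
  case True
  \<comment> \<open>Positivity is postulated for nonzero vectors only; at the zero vector
    homogeneity with factor 0 gives the value 0.\<close>
  then have "tscale 0 \<xi> = \<xi>" by (simp add: tscale_def)
  then show ?thesis using metric_tscale[OF assms assms(2), of 0] by simp
next
  case False
  then show ?thesis using assms unfolding riemannian_metric_def by (meson less_imp_le)
qed

lemma tnorm_nonneg:
  assumes "riemannian_metric A g" "\<xi> \<in> tangent_space A p"
  shows "tnorm g p \<xi> \<ge> 0"
  using metric_nonneg[OF assms] by (simp add: tnorm_def)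

lemma tnorm_tscale:
  assumes "smooth_atlas A" "riemannian_metric A g" "\<xi> \<in> tangent_space A p"
  shows "tnorm g p (tscale a \<xi>) = \<bar>a\<bar> * tnorm g p \<xi>"
proof -
  have a\<xi>: "tscale a \<xi> \<in> tangent_space A p" by (rule tscale_in_tangent_space[OF assms(1,3)])
  have sym: "g p \<xi> (tscale a \<xi>) = g p (tscale a \<xi>) \<xi>"
    using assms(2,3) a\<xi> unfolding riemannian_metric_def by meson
  have "g p (tscale a \<xi>) (tscale a \<xi>) = a\<^sup>2 * g p \<xi> \<xi>"
    using metric_tscale[OF assms(2,3) a\<xi>, of a] sym metric_tscale[OF assms(2,3,3), of a]
    by (simp add: power2_eq_square)
  then show ?thesis by (simp add: tnorm_def real_sqrt_mult)
qed

section \<open>Velocities and lengths of curves\<close>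

lemma has_velocityD:
  assumes "has_velocity A \<gamma> I t \<xi>"
  shows "\<xi> \<in> tangent_space A (\<gamma> t)" and "continuous (at t within I) \<gamma>"
    and "c \<in> charts_at A (\<gamma> t) \<Longrightarrow> ((snd c \<circ> \<gamma>) has_vector_derivative \<xi> c) (at t within I)"
    and "c \<notin> charts_at A (\<gamma> t) \<Longrightarrow> \<xi> c = 0"
  using assms tangent_space_outside[of \<xi> A "\<gamma> t" c] by (simp_all add: has_velocity_def)

text \<open>In charts around the point derivatives are unique, and in all others the padding by 0
  decides. This makes the description that defines \<open>velocity\<close> meaningful.\<close>

lemma has_velocity_unique:
  assumes "has_velocity A \<gamma> I t \<xi>" "has_velocity A \<gamma> I t \<zeta>" "at t within I \<noteq> bot"
  shows "\<xi> = \<zeta>"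
proof
  fix c show "\<xi> c = \<zeta> c"
  proof (cases "c \<in> charts_at A (\<gamma> t)")
    case True
    then show ?thesis
      using vector_derivative_unique_within[OF assms(3) has_velocityD(3)[OF assms(1)] has_velocityD(3)[OF assms(2)]]
      by simp
  next
    case False
    then show ?thesis
      using has_velocityD(4)[OF assms(1)] has_velocityD(4)[OF assms(2)] by simp
  qed
qed

lemma at_within_unit_interval_nonbot: "t \<in> {0..1} \<Longrightarrow> at t within {0..1::real} \<noteq> bot"
  by (simp add: trivial_limit_within islimpt_Icc)

lemma velocity_eq:
  assumes "has_velocity A \<gamma> {0..1} t \<xi>" "t \<in> {0..1}"
  shows "velocity A \<gamma> t = \<xi>"
  unfolding velocity_def
  by (rule the_equality, rule assms(1))
    (rule has_velocity_unique[OF _ assms(1) at_within_unit_interval_nonbot[OF assms(2)]])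

text \<open>At a break point the one-sided derivatives may differ, so \<open>velocity\<close> can be
  arbitrary there. Any other time lies strictly between neighbouring break points.\<close>

lemma piecewise_C1_curve_velocity:
  assumes "piecewise_C1_curve A \<gamma>"
  obtains F where "finite F" "\<And>t. t \<in> {0..1} - F \<Longrightarrow> velocity A \<gamma> t \<in> tangent_space A (\<gamma> t)"
proof -
  obtain F where F: "finite F" "{0, 1} \<subseteq> F" "F \<subseteq> {0..1}"
    and C1: "\<forall>a\<in>F. \<forall>b\<in>F. a < b \<and> F \<inter> {a<..<b} = {} \<longrightarrow> C1_curve_on A a b \<gamma>"
    using assms unfolding piecewise_C1_curve_def by (elim conjE exE) simp
  have "velocity A \<gamma> t \<in> tangent_space A (\<gamma> t)" if t: "t \<in> {0..1} - F" for t
  proof -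
    define a where "a = Max {x\<in>F. x < t}"
    define b where "b = Min {x\<in>F. t < x}"
    have "0 \<in> {x\<in>F. x < t}" "1 \<in> {x\<in>F. t < x}" using F t by (auto simp: less_le)
    then have "a \<in> {x\<in>F. x < t}" "b \<in> {x\<in>F. t < x}"
      unfolding a_def b_def using F(1) by (intro Max_in Min_in; auto)+
    then have ab: "a \<in> F" "b \<in> F" "a < t" "t < b" by auto
    have "x \<le> a \<or> b \<le> x" if "x \<in> F" for x
    proof (cases "x < t")
      case True then show ?thesis unfolding a_def using F(1) that by auto
    next
      case False
      then have "t < x" using that t by (metis DiffD2 linorder_neqE_linordered_idom)
      then show ?thesis unfolding b_def using F(1) that by auto
    qed
    then have "F \<inter> {a<..<b} = {}" by force
    then have "C1_curve_on A a b \<gamma>" using C1 ab by auto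
    then obtain \<xi> where \<xi>: "has_velocity A \<gamma> {a..b} t \<xi>"
      unfolding C1_curve_on_def using ab by fastforce
    \<comment> \<open>At an interior time the derivatives within the piece and within the unit
      interval are both two-sided, hence equal.\<close>
    have "at t within {a..b} = at t" "at t within {0..1} = at t"
      using ab F(3) by (auto intro!: at_within_Icc_at)
    then have "has_velocity A \<gamma> {0..1} t \<xi>" using \<xi> unfolding has_velocity_def by simp
    then show ?thesis using velocity_eq[of A \<gamma> t \<xi>] has_velocityD(1) t by auto
  qed
  then show ?thesis using that F(1) by blast
qed

text \<open>Finitely many break points do not affect the integral, and elsewhere the integrand is a
  norm. Lengths bounded below are what makes the infimum in \<open>riem_dist\<close> usable.\<close>

lemma curve_length_nonneg:
  assumes "riemannian_metric A g" "piecewise_C1_curve A \<gamma>"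
  shows "curve_length A g \<gamma> \<ge> 0"
proof -
  obtain F where F: "finite F" "\<And>t. t \<in> {0..1} - F \<Longrightarrow> velocity A \<gamma> t \<in> tangent_space A (\<gamma> t)"
    using piecewise_C1_curve_velocity[OF assms(2)] by blast
  let ?h = "\<lambda>t. if t \<in> F then 0 else tnorm g (\<gamma> t) (velocity A \<gamma> t)"
  have "curve_length A g \<gamma> = integral {0..1} ?h"
    unfolding curve_length_def
    by (rule integral_spike[OF negligible_finite[OF F(1)]]) auto
  also have "\<dots> \<ge> 0"
  \<comment> \<open>Without integrability the integral has the default value 0.\<close>
  proof (cases "?h integrable_on {0..1}")
    case True
    then show ?thesis
      by (rule Henstock_Kurzweil_Integration.integral_nonneg)
        (use F(2) tnorm_nonneg[OF assms(1)] in auto)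
  qed (simp add: not_integrable_integral)
  finally show ?thesis .
qed

text \<open>In each chart the first derivative is itself differentiable, hence continuous; the chain
  rule through the transition maps joins the coordinate derivatives into one tangent vector.\<close>

lemma geodesic_C1:
  assumes A: "smooth_atlas A" and "is_geodesic A g \<gamma>"
  shows "C1_curve_on A 0 1 \<gamma>"
proof -
  have cont: "continuous_on {0..1} \<gamma>" using assms(2) by (simp add: is_geodesic_def)
  let ?Z = "\<lambda>c. {s\<in>{0..1}. \<gamma> s \<in> fst c}"
  have "\<exists>x'. continuous_on (?Z c) x' \<and>
      (\<forall>t\<in>?Z c. ((snd c \<circ> \<gamma>) has_vector_derivative x' t) (at t within ?Z c))" if c: "c \<in> A" for c
  proof -
    obtain x' x'' where x: "\<forall>t\<in>?Z c. ((snd c \<circ> \<gamma>) has_vector_derivative x' t) (at t within ?Z c)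
        \<and> (x' has_vector_derivative x'' t) (at t within ?Z c)"
      using assms(2) c unfolding is_geodesic_def by meson
    then have "continuous_on (?Z c) x'"
      unfolding continuous_on_eq_continuous_within using has_vector_derivative_continuous by blast
    then show ?thesis using x by blast
  qed
  then have "\<forall>c\<in>A. \<exists>x'. continuous_on (?Z c) x' \<and>
      (\<forall>t\<in>?Z c. ((snd c \<circ> \<gamma>) has_vector_derivative x' t) (at t within ?Z c))" ..
  from bchoice[OF this] obtain x' where x': "\<forall>c\<in>A. continuous_on (?Z c) (x' c) \<and>
      (\<forall>t\<in>?Z c. ((snd c \<circ> \<gamma>) has_vector_derivative x' c t) (at t within ?Z c))"
    by (elim exE)
  \<comment> \<open>The times spent in an open set form a relatively open set, so restricting to
    them does not change the filter at \<open>t\<close>.\<close>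
  have nbhd: "at t within {s\<in>{0..1}. \<gamma> s \<in> U} = at t within {0..1}"
    if "open U" "\<gamma> t \<in> U" "t \<in> {0..1}" for U t
  proof -
    obtain V where V: "open V" "V \<inter> {0..1} = \<gamma> -` U \<inter> {0..1}"
      using continuous_on_open_invariant[THEN iffD1, OF cont, rule_format, OF \<open>open U\<close>] by blast
    have "t \<in> V" using V(2) \<open>\<gamma> t \<in> U\<close> \<open>t \<in> {0..1}\<close> by blast
    moreover have eq: "{s\<in>{0..1}. \<gamma> s \<in> U} = V \<inter> {0..1}" using V(2) by blast
    ultimately show ?thesis
      unfolding eq using V(1) by (intro at_within_nhd[of t V]) blast+
  qed
  have opn: "open (fst c)" if "c \<in> A" for c
    using A that unfolding smooth_atlas_def is_chart_def by blast
  \<comment> \<open>\<open>x' c\<close> carries information only while the curve is in the chart;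
    elsewhere the encoding of tangent vectors requires 0.\<close>
  define \<xi> where "\<xi> t c = (if c \<in> charts_at A (\<gamma> t) then x' c t else 0)" for t c
  have der: "((snd c \<circ> \<gamma>) has_vector_derivative \<xi> t c) (at t within {0..1})"
    if "t \<in> {0..1}" "c \<in> charts_at A (\<gamma> t)" for c t
  proof -
    have c: "c \<in> A" "\<gamma> t \<in> fst c" using that by (auto simp: charts_at_def)
    then have "((snd c \<circ> \<gamma>) has_vector_derivative x' c t) (at t within ?Z c)"
      using x' that(1) by simp
    then show ?thesis
      unfolding nbhd[OF opn[OF c(1)] c(2) that(1)] using that by (simp add: \<xi>_def)
  qed
  \<comment> \<open>Along the curve the second chart is the transition map applied to the first;
    compare the chain rule with the direct derivative.\<close>
  have tangent: "\<xi> t c' = frechet_derivative (transition c c') (at (snd c (\<gamma> t))) (\<xi> t c)"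
    if t: "t \<in> {0..1}" and c: "c \<in> charts_at A (\<gamma> t)" and c': "c' \<in> charts_at A (\<gamma> t)" for c c' t
  proof -
    let ?D = "frechet_derivative (transition c c') (at (snd c (\<gamma> t)))"
    let ?W = "{s\<in>{0..1}. \<gamma> s \<in> fst c}"
    have D: "(transition c c' has_derivative ?D) (at ((snd c \<circ> \<gamma>) t))"
      using transition_differentiable[OF A c c'] frechet_derivative_works by auto
    have W: "at t within ?W = at t within {0..1}"
      using nbhd[of "fst c" t] opn[of c] c t by (auto simp: charts_at_def)
    have "((\<lambda>s. transition c c' ((snd c \<circ> \<gamma>) s)) has_derivative (\<lambda>h. ?D (h *\<^sub>R \<xi> t c))) (at t within ?W)"
      using der[OF t c] D unfolding W has_vector_derivative_def by (rule has_derivative_compose)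
    moreover have "linear ?D"
      using D has_derivative_linear by blast
    ultimately have "((\<lambda>s. transition c c' ((snd c \<circ> \<gamma>) s)) has_vector_derivative ?D (\<xi> t c)) (at t within ?W)"
      by (simp add: has_vector_derivative_def linear_cmul)
    then have "((snd c' \<circ> \<gamma>) has_vector_derivative ?D (\<xi> t c)) (at t within ?W)"
      by (rule has_vector_derivative_transform[rotated 2])
        (use t c transition_chart[OF A] in \<open>auto simp: charts_at_def\<close>)
    then show ?thesis
      unfolding W
      by (rule vector_derivative_unique_within[OF at_within_unit_interval_nonbot[OF t] der[OF t c']])
  qed
  have "has_velocity A \<gamma> {0..1} t (\<xi> t)" if t: "t \<in> {0..1}" for t
    unfolding has_velocity_def
  proof (intro conjI ballI)
    show "\<xi> t \<in> tangent_space A (\<gamma> t)"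
      unfolding tangent_space_def
    proof (intro CollectI conjI allI impI ballI)
      show "\<xi> t c = 0" if "c \<notin> charts_at A (\<gamma> t)" for c using that by (simp add: \<xi>_def)
    qed (rule tangent[OF t])
    show "continuous (at t within {0..1}) \<gamma>"
      using cont t by (simp add: continuous_on_eq_continuous_within)
  qed (rule der[OF t])
  moreover have "continuous_on {t\<in>{0..1}. \<gamma> t \<in> fst c} (\<lambda>t. \<xi> t c)" if c: "c \<in> A" for c
  proof (rule continuous_on_eq)
    show "continuous_on {t\<in>{0..1}. \<gamma> t \<in> fst c} (x' c)"
      using x' c by simp
  qed (use c in \<open>auto simp: \<xi>_def charts_at_def\<close>)
  ultimately show ?thesis unfolding C1_curve_on_def by blast
qed

lemma C1_curve_has_velocity:
  assumes "C1_curve_on A 0 1 \<gamma>" "t \<in> {0..1}"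
  shows "has_velocity A \<gamma> {0..1} t (velocity A \<gamma> t)"
  using assms velocity_eq unfolding C1_curve_on_def by metis

section \<open>Subarcs and Lipschitz curves\<close>

lemma affine_in_unit_interval:
  fixes r s t :: real
  assumes "s \<in> {0..1}" "t \<in> {0..1}" "r \<in> {0..1}"
  shows "s + r * (t - s) \<in> {0..1}"
proof -
  have "s + r * (t - s) = (1 - r) * s + r * t" by (simp add: algebra_simps)
  moreover have "(1 - r) * s + r * t \<le> (1 - r) * 1 + r * 1"
    using assms by (intro add_mono mult_left_mono) auto
  ultimately show ?thesis using assms by auto
qed

text \<open>The affine reparametrization also allows \<open>t \<le> s\<close>: the factor
  \<open>t - s\<close> then reverses the arc or makes it constant.\<close>

lemma C1_subcurve:
  fixes \<gamma> :: "real \<Rightarrow> 'm::topological_space"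
  assumes A: "smooth_atlas A" and \<gamma>: "C1_curve_on A 0 1 \<gamma>" and st: "s \<in> {0..1}" "t \<in> {0..1}"
  defines "\<sigma> \<equiv> \<lambda>r. \<gamma> (s + r * (t - s))"
  shows "piecewise_C1_curve A \<sigma>"
    and "r \<in> {0..1} \<Longrightarrow> velocity A \<sigma> r = tscale (t - s) (velocity A \<gamma> (s + r * (t - s)))"
proof -
  let ?l = "\<lambda>r. s + r * (t - s)"
  note l = affine_in_unit_interval[OF st]
  note vel = C1_curve_has_velocity[OF \<gamma>]
  have cont\<gamma>: "continuous_on {0..1} \<gamma>"
    using has_velocityD(2)[OF vel] by (simp add: continuous_on_eq_continuous_within)
  have cont\<sigma>: "continuous_on {0..1} \<sigma>"
    unfolding \<sigma>_def by (rule continuous_on_compose2[OF cont\<gamma>], intro continuous_intros, rule image_subsetI, rule l)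
  have v\<sigma>: "has_velocity A \<sigma> {0..1} r (tscale (t - s) (velocity A \<gamma> (?l r)))" if r: "r \<in> {0..1}" for r
    unfolding has_velocity_def
  proof (intro conjI ballI)
    show "tscale (t - s) (velocity A \<gamma> (?l r)) \<in> tangent_space A (\<sigma> r)"
      using tscale_in_tangent_space[OF A has_velocityD(1)[OF vel[OF l[OF r]]]] by (simp add: \<sigma>_def)
    show "continuous (at r within {0..1}) \<sigma>"
      using cont\<sigma> r by (simp add: continuous_on_eq_continuous_within)
    fix c assume "c \<in> charts_at A (\<sigma> r)"
    then have "((snd c \<circ> \<gamma>) has_vector_derivative velocity A \<gamma> (?l r) c) (at (?l r) within {0..1})"
      using has_velocityD(3)[OF vel[OF l[OF r]]] by (simp add: \<sigma>_def)
    then have "((snd c \<circ> \<gamma>) has_vector_derivative velocity A \<gamma> (?l r) c) (at (?l r) within ?l ` {0..1})"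
      by (rule has_vector_derivative_within_subset) (rule image_subsetI, rule l)
    moreover have "(?l has_vector_derivative (t - s)) (at r within {0..1})"
      by (auto intro!: derivative_eq_intros)
    ultimately have "(((snd c \<circ> \<gamma>) \<circ> ?l) has_vector_derivative (t - s) *\<^sub>R velocity A \<gamma> (?l r) c) (at r within {0..1})"
      by (intro vector_diff_chain_within)
    then show "((snd c \<circ> \<sigma>) has_vector_derivative tscale (t - s) (velocity A \<gamma> (?l r)) c) (at r within {0..1})"
      by (simp add: o_def \<sigma>_def tscale_def)
  qed
  have "continuous_on {r\<in>{0..1}. \<sigma> r \<in> fst c} (\<lambda>r. tscale (t - s) (velocity A \<gamma> (?l r)) c)" if c: "c \<in> A" for c
  proof -
    obtain \<xi> where \<xi>: "\<And>t. t \<in> {0..1} \<Longrightarrow> has_velocity A \<gamma> {0..1} t (\<xi> t)"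
      "continuous_on {t\<in>{0..1}. \<gamma> t \<in> fst c} (\<lambda>t. \<xi> t c)"
      using \<gamma> c unfolding C1_curve_on_def by blast
    have "continuous_on {t\<in>{0..1}. \<gamma> t \<in> fst c} (\<lambda>t. velocity A \<gamma> t c)"
      by (rule continuous_on_eq[OF \<xi>(2)]) (use velocity_eq[OF \<xi>(1)] in auto)
    then show ?thesis
      unfolding tscale_def
      by (intro continuous_on_scaleR continuous_on_const, elim continuous_on_compose2)
        (use l in \<open>auto simp: \<sigma>_def intro!: continuous_intros\<close>)
  qed
  then have "C1_curve_on A 0 1 \<sigma>"
    unfolding C1_curve_on_def
    by (intro exI[of _ "\<lambda>r. tscale (t - s) (velocity A \<gamma> (?l r))"] conjI ballI v\<sigma>)
  then show "piecewise_C1_curve A \<sigma>"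
    unfolding piecewise_C1_curve_def using cont\<sigma> by (intro conjI exI[of _ "{0, 1}"]) auto
  show "velocity A \<sigma> r = tscale (t - s) (velocity A \<gamma> (?l r))" if "r \<in> {0..1}"
    using velocity_eq[OF v\<sigma>[OF that] that] .
qed

text \<open>The arc between two times is a competitor in the infimum defining the distance, and its
  length is speed times elapsed time. This makes the flow assumption applicable to
  geodesics.\<close>

lemma constant_speed_lipschitz_curve:
  assumes A: "smooth_atlas A" and g: "riemannian_metric A g" and \<gamma>: "C1_curve_on A 0 1 \<gamma>"
    and S: "\<gamma> ` {0..1} \<subseteq> S" and h: "\<And>t. t \<in> {0..1} \<Longrightarrow> tnorm g (\<gamma> t) (velocity A \<gamma> t) = h"
  shows "lipschitz_curve A g S \<gamma>"
  unfolding lipschitz_curve_def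
proof (intro conjI exI[of _ h] ballI S)
  fix s t :: real assume st: "s \<in> {0..1}" "t \<in> {0..1}"
  let ?l = "\<lambda>r. s + r * (t - s)"
  let ?\<sigma> = "\<lambda>r. \<gamma> (?l r)"
  note sub = C1_subcurve[OF A \<gamma> st]
  note l = affine_in_unit_interval[OF st]
  have "tnorm g (?\<sigma> r) (velocity A ?\<sigma> r) = \<bar>t - s\<bar> * h" if r: "r \<in> {0..1}" for r
    using tnorm_tscale[OF A g has_velocityD(1)[OF C1_curve_has_velocity[OF \<gamma> l[OF r]]]]
      sub(2)[OF r] h[OF l[OF r]] by simp
  then have "curve_length A g ?\<sigma> = integral {0..1::real} (\<lambda>r. \<bar>t - s\<bar> * h)"
    unfolding curve_length_def by (intro integral_cong) auto
  then have len: "curve_length A g ?\<sigma> = h * \<bar>s - t\<bar>"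
    by (simp add: abs_minus_commute)
  have "riem_dist A g S (\<gamma> s) (\<gamma> t) \<le> curve_length A g ?\<sigma>"
    unfolding riem_dist_def
  proof (rule cInf_lower)
    have "?\<sigma> ` {0..1} \<subseteq> S" using l S by blast
    then show "curve_length A g ?\<sigma> \<in> {curve_length A g \<gamma>' |\<gamma>'. piecewise_C1_curve A \<gamma>' \<and>
        \<gamma>' ` {0..1} \<subseteq> S \<and> \<gamma>' 0 = \<gamma> s \<and> \<gamma>' 1 = \<gamma> t}"
      using sub(1) by fastforce
    show "bdd_below {curve_length A g \<gamma>' |\<gamma>'. piecewise_C1_curve A \<gamma>' \<and>
        \<gamma>' ` {0..1} \<subseteq> S \<and> \<gamma>' 0 = \<gamma> s \<and> \<gamma>' 1 = \<gamma> t}"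
      using curve_length_nonneg[OF g] by (intro bdd_belowI[of _ 0]) auto
  qed
  then show "riem_dist A g S (\<gamma> s) (\<gamma> t) \<le> h * \<bar>s - t\<bar>" using len by simp
qed

section \<open>Optimal maps along geodesics\<close>

text \<open>The operator norm bound becomes a Lipschitz bound by the mean value inequality. The sign
  of \<open>m\<close> matters because \<open>ennreal\<close> truncates negative numbers to
  0.\<close>

lemma C1_norm_bound:
  fixes f :: "'a::euclidean_space \<Rightarrow> 'a"
  assumes C1: "C1_norm f \<le> ennreal m" and m: "m \<ge> 0" and diff: "\<And>x. f differentiable (at x)"
  shows "norm (f x) \<le> m" and "norm (f x - f y) \<le> m * norm (x - y)"
proof -
  have "ennreal (norm (f x)) \<le> C1_norm f" for x
    unfolding C1_norm_def by (intro max.coboundedI1 SUP_upper) simp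
  then show "norm (f x) \<le> m"
    using C1 m order_trans ennreal_le_iff by blast
  have "ennreal (onorm (frechet_derivative f (at x))) \<le> C1_norm f" for x
    unfolding C1_norm_def by (intro max.coboundedI2 SUP_upper) simp
  then have "onorm (frechet_derivative f (at x)) \<le> m" for x
    using C1 m order_trans ennreal_le_iff by blast
  then show "norm (f x - f y) \<le> m * norm (x - y)"
    using diff frechet_derivative_works by (intro differentiable_bound[of UNIV f]) auto
qed

lemma geodesic_spaceD:
  assumes "geodesic_space A g S D" "(\<theta>, \<eta>) \<in> D"
    and \<gamma>_def: "\<gamma> = (\<lambda>t. riem_exp A g \<theta> (tscale t \<eta>))"
  shows "\<gamma> ` {0..1} \<subseteq> S" and "\<gamma> 0 = \<theta>" and "velocity A \<gamma> 0 = \<eta>"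
    and "C1_curve_on A 0 1 \<gamma>" and "lipschitz_curve A g S \<gamma>"
    and "tnorm g \<theta> \<eta> = riem_dist A g S \<theta> (\<gamma> 1)" and "tnorm g \<theta> \<eta> \<ge> 0"
proof -
  have A: "smooth_atlas A" and g: "riemannian_metric A g"
    using assms(1) by (simp_all add: geodesic_space_def connected_riemannian_manifold_def)
  have "\<forall>(\<theta>, \<eta>)\<in>D. let \<gamma> = (\<lambda>t. riem_exp A g \<theta> (tscale t \<eta>)) in
        geodesic_from A g \<theta> \<eta> \<gamma> \<and> \<gamma> ` {0..1} \<subseteq> S \<and>
        (\<forall>t\<in>{0..1}. tnorm g (\<gamma> t) (velocity A \<gamma> t) = tnorm g \<theta> \<eta>) \<and>
        tnorm g \<theta> \<eta> = riem_dist A g S \<theta> (riem_exp A g \<theta> \<eta>)"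
    using assms(1) unfolding geodesic_space_def by (elim conjE)
  from bspec[OF this assms(2)] have geo: "geodesic_from A g \<theta> \<eta> \<gamma>" and S: "\<gamma> ` {0..1} \<subseteq> S"
    and speed: "\<And>t. t \<in> {0..1} \<Longrightarrow> tnorm g (\<gamma> t) (velocity A \<gamma> t) = tnorm g \<theta> \<eta>"
    and dist: "tnorm g \<theta> \<eta> = riem_dist A g S \<theta> (riem_exp A g \<theta> \<eta>)"
    by (simp_all add: Let_def \<gamma>_def)
  show "\<gamma> ` {0..1} \<subseteq> S" by (rule S)
  show \<theta>: "\<gamma> 0 = \<theta>" using geo by (simp add: geodesic_from_def)
  have vel0: "has_velocity A \<gamma> {0..1} 0 \<eta>" using geo by (simp add: geodesic_from_def)
  then show "velocity A \<gamma> 0 = \<eta>" by (rule velocity_eq) simp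
  show C1: "C1_curve_on A 0 1 \<gamma>" using geodesic_C1[OF A, of g \<gamma>] geo by (simp add: geodesic_from_def)
  show "lipschitz_curve A g S \<gamma>" by (rule constant_speed_lipschitz_curve[OF A g C1 S speed])
  have "tscale 1 \<eta> = \<eta>" by (simp add: tscale_def)
  then show "tnorm g \<theta> \<eta> = riem_dist A g S \<theta> (\<gamma> 1)" using dist by (simp add: \<gamma>_def)
  show "tnorm g \<theta> \<eta> \<ge> 0" using tnorm_nonneg[OF g has_velocityD(1)[OF vel0]] \<theta> by simp
qed

lemma velocity_fieldsD:
  assumes "velocity_fields A g S D E B"
  shows "\<And>\<theta> \<xi>. \<theta> \<in> S \<Longrightarrow> \<xi> \<in> tangent_space A \<theta> \<Longrightarrow> B \<theta> \<xi> differentiable (at x)"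
    and "\<And>\<theta> \<xi>. \<theta> \<in> S \<Longrightarrow> \<xi> \<in> tangent_space A \<theta> \<Longrightarrow> gradient_field (B \<theta> \<xi>)"
    and "\<exists>C\<^sub>0>0. \<forall>\<theta> \<eta>. (\<theta>, \<eta>) \<in> D \<longrightarrow> (let \<gamma> = (\<lambda>t. riem_exp A g \<theta> (tscale t \<eta>)) in
        C1_norm (B \<theta> \<eta>) \<le> ennreal (C\<^sub>0 * tnorm g \<theta> \<eta>) \<and>
        (\<forall>x. \<forall>t\<in>{0..1}. \<exists>w.
           ((\<lambda>s. B (\<gamma> s) (velocity A \<gamma> s) x) has_vector_derivative w) (at t within {0..1}) \<and>
           norm w \<le> C\<^sub>0 * (tnorm g \<theta> \<eta>)\<^sup>2))"
proof -
  have *: "\<forall>\<theta>\<in>S. \<forall>\<xi>\<in>tangent_space A \<theta>. Ck_on 1 UNIV (B \<theta> \<xi>) \<and> gradient_field (B \<theta> \<xi>)"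
    using assms unfolding velocity_fields_def by blast
  fix \<theta> \<xi> assume "\<theta> \<in> S" "\<xi> \<in> tangent_space A \<theta>"
  with * show "B \<theta> \<xi> differentiable (at x)" "gradient_field (B \<theta> \<xi>)" by auto
next
  show "\<exists>C\<^sub>0>0. \<forall>\<theta> \<eta>. (\<theta>, \<eta>) \<in> D \<longrightarrow> (let \<gamma> = (\<lambda>t. riem_exp A g \<theta> (tscale t \<eta>)) in
        C1_norm (B \<theta> \<eta>) \<le> ennreal (C\<^sub>0 * tnorm g \<theta> \<eta>) \<and>
        (\<forall>x. \<forall>t\<in>{0..1}. \<exists>w.
           ((\<lambda>s. B (\<gamma> s) (velocity A \<gamma> s) x) has_vector_derivative w) (at t within {0..1}) \<and>
           norm w \<le> C\<^sub>0 * (tnorm g \<theta> \<eta>)\<^sup>2))"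
    using assms unfolding velocity_fields_def Let_def by (elim conjE exE) (rule exI, auto)
qed

text \<open>For fixed \<open>t\<close> the flow along the geodesic is the competitor. Here
  \<open>b\<close> bounds the initial field and its Lipschitz constant, and \<open>c\<close> its
  change in time, so the two flow estimates supply the constants for the comparison of maps.\<close>

lemma optimal_map_near_velocity:
  fixes B :: "'m::{t2_space,second_countable_topology} \<Rightarrow> ('m, 'e::euclidean_space) tvec \<Rightarrow>
      'a::euclidean_space \<Rightarrow> 'a"
  assumes \<Omega>: "compact \<Omega>" and geo: "geodesic_space A g S D"
    and E: "E ` S \<subseteq> prob_measures_on \<Omega>" and B: "velocity_fields A g S D E B"
    and flows: "transported_by_flows A g S \<Omega> E B" and D: "(\<theta>, \<eta>) \<in> D"
    and C1: "C1_norm (B \<theta> \<eta>) \<le> ennreal b" and b: "b \<ge> 0"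
    and der: "\<And>x t. t \<in> {0..1} \<Longrightarrow> \<exists>w. ((\<lambda>s. B (riem_exp A g \<theta> (tscale s \<eta>))
        (velocity A (\<lambda>t. riem_exp A g \<theta> (tscale t \<eta>)) s) x) has_vector_derivative w)
        (at t within {0..1}) \<and> norm w \<le> c"
    and t: "t \<in> {0..1}" and T: "optimal_map (E \<theta>) (E (riem_exp A g \<theta> (tscale t \<eta>))) T"
  shows "AE x in E \<theta>. x \<in> \<Omega>" and "AE x in E \<theta>. T x \<in> \<Omega>" and "T \<in> borel_measurable (E \<theta>)"
    and "continuous_on UNIV (B \<theta> \<eta>)"
    and "(\<integral>x. (norm (T x - x - t *\<^sub>R B \<theta> \<eta> x))\<^sup>2 \<partial>E \<theta>)
      \<le> ((c + b * (b + c)) * t\<^sup>2)\<^sup>2 + 4 * t * b * ((b + c) * t)\<^sup>2"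
proof -
  define \<gamma> where "\<gamma> = (\<lambda>t. riem_exp A g \<theta> (tscale t \<eta>))"
  note \<gamma> = geodesic_spaceD[OF geo D \<gamma>_def]
  define v where "v t = B (\<gamma> t) (velocity A \<gamma> t)" for t
  have v0: "v 0 = B \<theta> \<eta>" using \<gamma>(2,3) by (simp add: v_def)
  have in_S: "\<gamma> t \<in> S" and tan: "velocity A \<gamma> t \<in> tangent_space A (\<gamma> t)" if "t \<in> {0..1}" for t
    using \<gamma>(1) that has_velocityD(1)[OF C1_curve_has_velocity[OF \<gamma>(4) that]] by blast+
  have diff: "v t differentiable (at x)" if "t \<in> {0..1}" for t x
    unfolding v_def by (rule velocity_fieldsD(1)[OF B in_S[OF that] tan[OF that]])
  have cont: "continuous_on UNIV (v t)" if "t \<in> {0..1}" for t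
    using diff[OF that] differentiable_imp_continuous_within
    unfolding continuous_on_eq_continuous_within by auto
  have bound: "norm (B \<theta> \<eta> x) \<le> b" "norm (B \<theta> \<eta> x - B \<theta> \<eta> y) \<le> b * norm (x - y)" for x y
    using C1_norm_bound[OF C1 b] diff[of 0] v0 by simp_all
  have Lip_t: "norm (v t x - v s x) \<le> c * \<bar>t - s\<bar>" if "s \<in> {0..1}" "t \<in> {0..1}" for s t x
  proof -
    have "\<forall>t\<in>{0..1}. \<exists>w. ((\<lambda>s. v s x) has_vector_derivative w) (at t within {0..1}) \<and> norm w \<le> c"
      using der unfolding v_def \<gamma>_def by blast
    from bchoice[OF this] obtain w where
      "\<forall>t\<in>{0..1}. ((\<lambda>s. v s x) has_vector_derivative w t) (at t within {0..1}) \<and> norm (w t) \<le> c" ..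
    then show ?thesis
      using that by (intro vector_derivative_bound_Lipschitz[of "{0..1}" "\<lambda>s. v s x" w]) auto
  qed
  obtain \<phi> where flow: "flow_solution \<Omega> v \<phi>"
    and est: "\<And>t x. t \<in> {0..1} \<Longrightarrow> norm (\<phi> t x - x) \<le> (b + c) * t"
      "\<And>t x. t \<in> {0..1} \<Longrightarrow> norm (\<phi> t x - x - t *\<^sub>R v 0 x) \<le> (c + b * (b + c)) * t\<^sup>2"
    using flow_solution_exists[of v c b \<Omega>, OF cont Lip_t] bound unfolding v0 by blast
  have \<mu>: "E \<theta> \<in> prob_measures_on \<Omega>" using E in_S[of 0] \<gamma>(2) by auto
  have \<nu>: "E (\<gamma> t) \<in> prob_measures_on \<Omega>" using E in_S[OF t] by auto
  have "\<forall>t\<in>{0..1}. E (\<gamma> t) = distr (restrict_space (E (\<gamma> 0)) \<Omega>) borel (\<phi> t)"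
    using flows \<gamma>(5) flow unfolding transported_by_flows_def v_def by blast
  then have distr: "E (\<gamma> t) = distr (restrict_space (E \<theta>) \<Omega>) borel (\<phi> t)"
    using t \<gamma>(2) by simp
  define F where "F x = (if x \<in> \<Omega> then \<phi> t x else x)" for x
  have F: "F \<in> borel_measurable (E \<theta>)" "distr (E \<theta>) borel F = E (\<gamma> t)"
    using pushforward_extend[OF \<Omega> \<mu> \<nu> distr] by (simp_all add: F_def[abs_def])
  have s: "sets (E \<theta>) = sets borel" and p: "prob_space (E \<theta>)"
    using \<mu> by (auto simp: prob_measures_on_def)
  have T': "optimal_map (E \<theta>) (E (\<gamma> t)) T" using T by (simp add: \<gamma>_def)
  note opt = optimal_map_cheapest[OF s T' F]
  note mu_AE = AE_prob_measures_on[OF \<Omega> \<mu>] and nu_AE = AE_prob_measures_on[OF \<Omega> \<nu>]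
  have \<Omega>b: "{x \<in> space borel. x \<in> \<Omega>} \<in> sets borel" using borel_compact[OF \<Omega>] by simp
  \<comment> \<open>\<open>T\<close> pushes \<open>E \<theta>\<close> forward to
    \<open>E (\<gamma> t)\<close>, which is concentrated on \<open>\<Omega>\<close>.\<close>
  have T_AE: "AE x in E \<theta>. T x \<in> \<Omega>"
    by (rule AE_distr_iff[OF opt(1) \<Omega>b, unfolded opt(2), THEN iffD1, OF nu_AE])
  have F_AE: "AE x in E \<theta>. F x \<in> \<Omega>"
    by (rule AE_distr_iff[OF F(1) \<Omega>b, unfolded F(2), THEN iffD1, OF nu_AE])
  have "gradient_field (B \<theta> \<eta>)"
    using velocity_fieldsD(2)[OF B in_S[of 0] tan[of 0]] \<gamma>(2,3) by simp
  then obtain \<psi> where \<psi>: "\<And>x. GDERIV \<psi> x :> B \<theta> \<eta> x" unfolding gradient_field_def by blast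
  show "AE x in E \<theta>. x \<in> \<Omega>" "AE x in E \<theta>. T x \<in> \<Omega>" "T \<in> borel_measurable (E \<theta>)"
    "continuous_on UNIV (B \<theta> \<eta>)"
    using mu_AE T_AE opt(1) cont[of 0] v0 by simp_all
  show "(\<integral>x. (norm (T x - x - t *\<^sub>R B \<theta> \<eta> x))\<^sup>2 \<partial>E \<theta>)
      \<le> ((c + b * (b + c)) * t\<^sup>2)\<^sup>2 + 4 * t * b * ((b + c) * t)\<^sup>2"
  proof (rule cheaper_transport_near_gradient[OF p s \<Omega> \<psi> bound(2) opt(1) F(1) _ mu_AE T_AE F_AE opt(3)])
    show "distr (E \<theta>) borel T = distr (E \<theta>) borel F" using opt(2) F(2) by simp
    show "norm (F x - x - t *\<^sub>R B \<theta> \<eta> x) \<le> (c + b * (b + c)) * t\<^sup>2" if "x \<in> \<Omega>" for x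
      using est(2)[OF t, of x] that v0 by (simp add: F_def)
    show "norm (F x - x) \<le> (b + c) * t" if "x \<in> \<Omega>" for x
      using est(1)[OF t, of x] that by (simp add: F_def)
  qed (use t in auto)
qed

text \<open>The error must be quadratic in \<open>h\<close> with a uniform constant:
  \<open>b\<close> and \<open>c\<close> carry one and two factors \<open>h\<close>, and all surplus
  factors are bounded by \<open>H\<close>. The division by the square of \<open>t\<close> comes from
  the difference quotient \<open>w\<close>.\<close>

lemma scaled_transport_bound:
  fixes t h H C\<^sub>0 :: real
  assumes t: "0 < t" "t \<le> 1" and h: "0 \<le> h" "h \<le> H" and C0: "0 \<le> C\<^sub>0"
  defines "K \<equiv> C\<^sub>0 * (1 + H)"
  defines "b \<equiv> C\<^sub>0 * h" and "c \<equiv> C\<^sub>0 * h\<^sup>2"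
  shows "(((c + b * (b + c)) * t\<^sup>2)\<^sup>2 + 4 * t * b * ((b + c) * t)\<^sup>2) / t\<^sup>2
    \<le> ((C\<^sub>0 * (1 + K) * H)\<^sup>2 + 4 * C\<^sub>0 * H * K\<^sup>2) * (t * h\<^sup>2)"
proof -
  have K0: "K \<ge> 0" using h C0 by (simp add: K_def)
  have bc: "b + c \<le> K * h" "0 \<le> b + c" "0 \<le> b" "0 \<le> c"
  proof -
    have "h\<^sup>2 \<le> H * h" using h by (simp add: power2_eq_square mult_right_mono)
    then have "C\<^sub>0 * h\<^sup>2 \<le> C\<^sub>0 * (H * h)" using C0 by (intro mult_left_mono)
    then show "b + c \<le> K * h" by (simp add: b_def c_def K_def algebra_simps)
  qed (use h C0 in \<open>auto simp: b_def c_def\<close>)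
  have "c + b * (b + c) \<le> c + b * (K * h)" using bc by (intro add_left_mono mult_left_mono)
  also have "\<dots> = C\<^sub>0 * (1 + K) * h * h" by (simp add: b_def c_def power2_eq_square algebra_simps)
  also have "\<dots> \<le> C\<^sub>0 * (1 + K) * H * h"
    using h C0 K0 by (intro mult_right_mono mult_left_mono) auto
  finally have "c + b * (b + c) \<le> C\<^sub>0 * (1 + K) * H * h" .
  then have "(c + b * (b + c))\<^sup>2 \<le> (C\<^sub>0 * (1 + K) * H * h)\<^sup>2"
    using bc by (intro power_mono) auto
  moreover have "t\<^sup>2 \<le> t" using t by (simp add: power2_eq_square mult_left_le)
  ultimately have 1: "(c + b * (b + c))\<^sup>2 * t\<^sup>2 \<le> (C\<^sub>0 * (1 + K) * H * h)\<^sup>2 * t"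
    by (intro mult_mono) auto
  have "b \<le> C\<^sub>0 * H" using h C0 by (simp add: b_def mult_left_mono)
  moreover have "(b + c)\<^sup>2 \<le> (K * h)\<^sup>2" using bc by (intro power_mono) auto
  ultimately have "b * (b + c)\<^sup>2 \<le> C\<^sub>0 * H * (K * h)\<^sup>2"
    using h C0 by (intro mult_mono) auto
  then have 2: "4 * t * (b * (b + c)\<^sup>2) \<le> 4 * t * (C\<^sub>0 * H * (K * h)\<^sup>2)"
    using t by (intro mult_left_mono) auto
  have "(((c + b * (b + c)) * t\<^sup>2)\<^sup>2 + 4 * t * b * ((b + c) * t)\<^sup>2) / t\<^sup>2
      = (c + b * (b + c))\<^sup>2 * t\<^sup>2 + 4 * t * (b * (b + c)\<^sup>2)"
    using t by (simp add: power_mult_distrib add_divide_distrib power2_eq_square)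
  also have "\<dots> \<le> (C\<^sub>0 * (1 + K) * H * h)\<^sup>2 * t + 4 * t * (C\<^sub>0 * H * (K * h)\<^sup>2)"
    using 1 2 by (rule add_mono)
  also have "\<dots> = ((C\<^sub>0 * (1 + K) * H)\<^sup>2 + 4 * C\<^sub>0 * H * K\<^sup>2) * (t * h\<^sup>2)"
    by (simp only: power_mult_distrib) (simp add: algebra_simps)
  finally show ?thesis .
qed

lemma in_L2_bounded:
  assumes "finite_measure \<mu>" "f \<in> borel_measurable \<mu>" "AE x in \<mu>. norm (f x) \<le> m"
  shows "in_L2 \<mu> f"
proof -
  interpret finite_measure \<mu> by fact
  have "AE x in \<mu>. norm ((norm (f x))\<^sup>2) \<le> m\<^sup>2"
    using assms(3) by eventually_elim (simp add: power_mono)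
  then have "integrable \<mu> (\<lambda>x. (norm (f x))\<^sup>2)"
    using assms(2) by (intro integrable_const_bound) auto
  then show ?thesis using assms(2) by (simp add: in_L2_def)
qed

theorem proposition2p15:
  fixes A :: "('m::{t2_space,second_countable_topology}, 'e::euclidean_space) chart set"
    and g :: "('m, 'e) metric"
    and S :: "'m set"
    and D :: "('m \<times> ('m, 'e) tvec) set"
    and \<Omega> :: "'a::euclidean_space set"
    and E :: "'m \<Rightarrow> 'a measure"
    and B :: "'m \<Rightarrow> ('m, 'e) tvec \<Rightarrow> 'a \<Rightarrow> 'a"
  assumes "compact \<Omega>" and "convex \<Omega>"
    and "geodesic_space A g S D"
    and "wasserstein_embedding A g S \<Omega> E"
    and "velocity_fields A g S D E B"
    and "transported_by_flows A g S \<Omega> E B"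
  shows "\<exists>C>0. \<forall>(\<theta>, \<eta>)\<in>D. \<forall>T :: real \<Rightarrow> 'a \<Rightarrow> 'a.
    (\<forall>t\<in>{0<..1}. optimal_map (E \<theta>) (E (riem_exp A g \<theta> (tscale t \<eta>))) (T t)) \<longrightarrow>
    (let v = B \<theta> \<eta>; w = (\<lambda>t x. (T t x - x) /\<^sub>R t) in
       in_L2 (E \<theta>) v \<and>
       (\<forall>t\<in>{0<..1}. in_L2 (E \<theta>) (w t)) \<and>
       ((\<lambda>t. L2_norm (E \<theta>) (\<lambda>x. w t x - v x)) \<longlongrightarrow> 0) (at_right 0) \<and>
       (\<forall>t\<in>{0<..<1 / C}.
          L2_norm (E \<theta>) (\<lambda>x. v x - w t x) \<le> C * sqrt t * tnorm g \<theta> \<eta>))"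
proof -
  note \<Omega> = assms(1) and geo = assms(3) and B = assms(5) and flows = assms(6)
  have E: "E ` S \<subseteq> prob_measures_on \<Omega>" using assms(4) by (simp add: wasserstein_embedding_def)
  obtain L where L: "L > 0"
    and distL: "\<And>p q. p \<in> S \<Longrightarrow> q \<in> S \<Longrightarrow> riem_dist A g S p q \<le> L * wasserstein (E p) (E q)"
    using assms(4) unfolding wasserstein_embedding_def by blast
  define d where "d = diameter \<Omega>"
  have d: "norm (x - y) \<le> d" if "x \<in> \<Omega>" "y \<in> \<Omega>" for x y
    using diameter_bounded_bound[OF compact_imp_bounded[OF \<Omega>] that] by (simp add: d_def dist_norm)
  have d0: "d \<ge> 0" using diameter_ge_0[OF compact_imp_bounded[OF \<Omega>]] by (simp add: d_def)
  \<comment> \<open>On \<open>D\<close> the tangent norm is a distance in \<open>S\<close>, hence at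
    most \<open>L\<close> times a Wasserstein distance, which is at most the diameter.\<close>
  define H where "H = L * d"
  obtain C\<^sub>0 where C0: "C\<^sub>0 > 0" and C0_bounds: "\<forall>\<theta> \<eta>. (\<theta>, \<eta>) \<in> D \<longrightarrow>
        (let \<gamma> = (\<lambda>t. riem_exp A g \<theta> (tscale t \<eta>)) in
        C1_norm (B \<theta> \<eta>) \<le> ennreal (C\<^sub>0 * tnorm g \<theta> \<eta>) \<and>
        (\<forall>x. \<forall>t\<in>{0..1}. \<exists>w.
           ((\<lambda>s. B (\<gamma> s) (velocity A \<gamma> s) x) has_vector_derivative w) (at t within {0..1}) \<and>
           norm w \<le> C\<^sub>0 * (tnorm g \<theta> \<eta>)\<^sup>2))"
    using velocity_fieldsD(3)[OF B] by blast
  define K where "K = C\<^sub>0 * (1 + H)"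
  define R where "R = (C\<^sub>0 * (1 + K) * H)\<^sup>2 + 4 * C\<^sub>0 * H * K\<^sup>2"
  have R0: "R \<ge> 0" using C0 L d0 by (simp add: R_def H_def)
  \<comment> \<open>\<open>C \<ge> 1\<close> puts \<open>(0, 1/C)\<close> inside
    \<open>(0, 1]\<close>, and the square of \<open>C\<close> dominates \<open>R\<close>, so the
    root of the squared error is controlled by \<open>C\<close>.\<close>
  define C where "C = 1 + R"
  have C: "C \<ge> 1" "R \<le> C\<^sup>2" using R0 by (auto simp: C_def power2_eq_square algebra_simps)
  show ?thesis
  proof (intro exI[of _ C] conjI ballI; clarify?)
    show "C > 0" using C by simp
    fix \<theta> \<eta> and T :: "real \<Rightarrow> 'a \<Rightarrow> 'a"
    assume D: "(\<theta>, \<eta>) \<in> D"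
      and T: "\<forall>t\<in>{0<..1}. optimal_map (E \<theta>) (E (riem_exp A g \<theta> (tscale t \<eta>))) (T t)"
    define h where "h = tnorm g \<theta> \<eta>"
    define v where "v = B \<theta> \<eta>"
    define w where "w t x = (T t x - x) /\<^sub>R t" for t x
    note \<gamma> = geodesic_spaceD[OF geo D refl]
    have h0: "h \<ge> 0" using \<gamma>(7) by (simp add: h_def)
    have \<gamma>S: "riem_exp A g \<theta> (tscale t \<eta>) \<in> S" if "t \<in> {0..1}" for t
      using \<gamma>(1) that by blast
    have \<theta>S: "\<theta> \<in> S" and \<gamma>1S: "riem_exp A g \<theta> (tscale 1 \<eta>) \<in> S"
      using \<gamma>S[of 0] \<gamma>S[of 1] \<gamma>(2) by simp_all
    have hH: "h \<le> H"
    proof -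
      have "h \<le> L * wasserstein (E \<theta>) (E (riem_exp A g \<theta> (tscale 1 \<eta>)))"
        using \<gamma>(6) distL[OF \<theta>S \<gamma>1S] by (simp add: h_def)
      also have "\<dots> \<le> L * d"
        using L E \<theta>S \<gamma>1S d d0 by (intro mult_left_mono wasserstein_le_diameter[OF \<Omega>]) auto
      finally show ?thesis by (simp add: H_def)
    qed
    have b0: "C\<^sub>0 * h \<ge> 0" using C0 h0 by simp
    have C1: "C1_norm (B \<theta> \<eta>) \<le> ennreal (C\<^sub>0 * h)"
      and der: "\<And>x t. t \<in> {0..1} \<Longrightarrow> \<exists>w. ((\<lambda>s. B (riem_exp A g \<theta> (tscale s \<eta>))
        (velocity A (\<lambda>t. riem_exp A g \<theta> (tscale t \<eta>)) s) x) has_vector_derivative w)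
        (at t within {0..1}) \<and> norm w \<le> C\<^sub>0 * h\<^sup>2"
      using C0_bounds D unfolding Let_def h_def by blast+
    have "optimal_map (E \<theta>) (E (riem_exp A g \<theta> (tscale t \<eta>))) (T t)" if "t \<in> {0<..1}" for t
      using T that by blast
    note near = optimal_map_near_velocity[OF \<Omega> geo E B flows D C1 b0 der _ this, folded v_def]
    have s: "sets (E \<theta>) = sets borel" and p: "prob_space (E \<theta>)"
      using E \<theta>S by (auto simp: prob_measures_on_def)
    interpret prob_space "E \<theta>" by (rule p)
    \<comment> \<open>The continuity of \<open>v\<close> does not depend on the time; 1 is just an
      admissible instance.\<close>
    have mv: "v \<in> borel_measurable (E \<theta>)"
      using borel_measurable_continuous_onI[OF near(4)[of 1]] by (simp add: measurable_cong_sets[OF s refl])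
    have mT: "T t \<in> borel_measurable (E \<theta>)" if "t \<in> {0<..1}" for t
      using near(3)[of t] that by simp
    have mw: "w t \<in> borel_measurable (E \<theta>)" if "t \<in> {0<..1}" for t
      unfolding w_def[abs_def] using mT[OF that] s
      by (intro borel_measurable_scaleR borel_measurable_diff) (auto simp: measurable_ident_sets)
    have "norm (v x) \<le> C\<^sub>0 * h" for x
    proof (rule C1_norm_bound(1)[of v, OF _ b0])
      show "C1_norm v \<le> ennreal (C\<^sub>0 * h)" using C1 by (simp add: v_def)
      have "\<eta> \<in> tangent_space A \<theta>"
        using has_velocityD(1)[OF C1_curve_has_velocity[OF \<gamma>(4), of 0]] \<gamma>(2,3) by simp
      then show "v differentiable (at x)" for x
        unfolding v_def by (rule velocity_fieldsD(1)[OF B \<theta>S])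
    qed
    then have L2v: "in_L2 (E \<theta>) v"
      using mv by (intro in_L2_bounded finite_measure_axioms) auto
    \<comment> \<open>Almost surely both \<open>x\<close> and \<open>T t x\<close> lie in
      \<open>\<Omega>\<close>, so the quotient is at most the diameter over \<open>t\<close>; square
      integrability at each fixed \<open>t\<close> needs no more.\<close>
    have L2w: "in_L2 (E \<theta>) (w t)" if t: "t \<in> {0<..1}" for t
    proof (rule in_L2_bounded[OF finite_measure_axioms mw[OF t]])
      have "AE x in E \<theta>. x \<in> \<Omega>" "AE x in E \<theta>. T t x \<in> \<Omega>" using near(1,2)[of t] t by auto
      then show "AE x in E \<theta>. norm (w t x) \<le> d / t"
      proof eventually_elim
        case (elim x)
        then show ?case using d[of "T t x" x] t by (simp add: w_def divide_simps)
      qed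
    qed
    \<comment> \<open>Since \<open>T t x - x - t *\<^sub>R v x\<close> equals
      \<open>t *\<^sub>R (w t x - v x)\<close>, the squared error is the transport estimate divided
      by the square of \<open>t\<close>.\<close>
    have rate: "L2_norm (E \<theta>) (\<lambda>x. v x - w t x) \<le> C * sqrt t * h" if t: "t \<in> {0<..1}" for t
    proof -
      have "(norm (v x - w t x))\<^sup>2 = (norm (T t x - x - t *\<^sub>R v x))\<^sup>2 / t\<^sup>2" for x
      proof -
        have "T t x - x - t *\<^sub>R v x = t *\<^sub>R (w t x - v x)"
          using t by (simp add: w_def scaleR_diff_right)
        then have "(norm (T t x - x - t *\<^sub>R v x))\<^sup>2 = t\<^sup>2 * (norm (w t x - v x))\<^sup>2"
          by (simp add: power_mult_distrib)
        then show ?thesis using t by (simp add: norm_minus_commute)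
      qed
      then have "(\<integral>x. (norm (v x - w t x))\<^sup>2 \<partial>E \<theta>)
          = (\<integral>x. (norm (T t x - x - t *\<^sub>R v x))\<^sup>2 \<partial>E \<theta>) / t\<^sup>2" by simp
      also have "\<dots> \<le> (((C\<^sub>0 * h\<^sup>2 + C\<^sub>0 * h * (C\<^sub>0 * h + C\<^sub>0 * h\<^sup>2)) * t\<^sup>2)\<^sup>2
          + 4 * t * (C\<^sub>0 * h) * ((C\<^sub>0 * h + C\<^sub>0 * h\<^sup>2) * t)\<^sup>2) / t\<^sup>2"
        using near(5)[of t] t by (intro divide_right_mono) auto
      also have "\<dots> \<le> R * (t * h\<^sup>2)"
        unfolding R_def K_def using t h0 hH C0 by (intro scaled_transport_bound) auto
      also have "\<dots> \<le> C\<^sup>2 * (t * h\<^sup>2)" using C(2) t by (intro mult_right_mono) auto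
      finally have "L2_norm (E \<theta>) (\<lambda>x. v x - w t x) \<le> sqrt (C\<^sup>2 * (t * h\<^sup>2))"
        unfolding L2_norm_def by (rule real_sqrt_le_mono)
      also have "\<dots> = C * sqrt t * h" using C h0 by (simp add: real_sqrt_mult)
      finally show ?thesis .
    qed
    \<comment> \<open>Strong convergence follows from the rate, whose bound vanishes with
      \<open>sqrt t\<close>.\<close>
    have lim: "((\<lambda>t. L2_norm (E \<theta>) (\<lambda>x. w t x - v x)) \<longlongrightarrow> 0) (at_right 0)"
    proof (rule Lim_null_comparison)
      have "\<forall>\<^sub>F t in at_right 0. t \<in> {0<..<1::real}"
        by (rule eventually_at_right_real) simp
      then show "\<forall>\<^sub>F t in at_right 0. norm (L2_norm (E \<theta>) (\<lambda>x. w t x - v x)) \<le> C * sqrt t * h"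
      proof eventually_elim
        case (elim t)
        then show ?case using rate[of t] by (simp add: L2_norm_def norm_minus_commute)
      qed
      have "((\<lambda>t. C * sqrt t * h) \<longlongrightarrow> C * sqrt 0 * h) (at_right 0)"
        by (intro tendsto_intros)
      then show "((\<lambda>t. C * sqrt t * h) \<longlongrightarrow> 0) (at_right 0)" by simp
    qed
    have "1 / C \<le> 1" using C(1) by simp
    then have "{0<..<1 / C} \<subseteq> {0<..1}"
      by (meson greaterThanAtMost_iff greaterThanLessThan_iff less_imp_le less_le_trans subsetI)
    then show "let v = B \<theta> \<eta>; w = (\<lambda>t x. (T t x - x) /\<^sub>R t) in
       in_L2 (E \<theta>) v \<and> (\<forall>t\<in>{0<..1}. in_L2 (E \<theta>) (w t)) \<and>
       ((\<lambda>t. L2_norm (E \<theta>) (\<lambda>x. w t x - v x)) \<longlongrightarrow> 0) (at_right 0) \<and>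
       (\<forall>t\<in>{0<..<1 / C}. L2_norm (E \<theta>) (\<lambda>x. v x - w t x) \<le> C * sqrt t * tnorm g \<theta> \<eta>)"
      using L2v L2w lim rate unfolding Let_def v_def w_def[abs_def] h_def by blast
  qed
qed

end
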